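(* Let $v$ be a packed word of length $n$. Then the expansion of $U_v(t)=(\sigma_1^t)_n*\mathbf{N}_v$ on the basis $(\mathbf{K}_x)$ of $\mathbf{WQSym}^*_n$ is $$U_v(t)=\sum_{x\in\mathrm{WRef}(v)}c_{m(v,x)}(t)\,\mathbf{K}_x,$$ where $m(v,x)$ is the refinement word of the pair $(v,x)$ and $c_m(t)$ denotes the $t$-Goldberg coefficient of the packed word $m$.
   Context: $\mathbb{K}$ is a field of characteristic $0$, $t$ an indeterminate. A word over the positive integers is packed if its set of letters is $\{1,\dots,r\}$ for some $r$; then $r=\max(u)$. For a word $w$ over a totally ordered alphabet with distinct letters $b_1<\dots<b_r$, $\mathrm{pack}(w)$ is obtained by replacing each $b_i$ by $i$. For packed words $v,x$ of length $n$, $x$ is a weak refinement of $v$, written $x\in\mathrm{WRef}(v)$, if $x_i=x_j\Rightarrow v_i=v_j$ for all $i,j$. In that case the refinement word $m(v,x)$ is the word of length $\max(x)$ whose $i$-th letter is $v_j$ for any $j$ with $x_j=i$. (Example: $m(12113,41223)=2131$.) $\mathbf{WQSym}^*_n$ is the $\mathbb{K}$-vector space with basis $\mathbf{N}_u$, $u$ running over packed words of length $n$, with internal product $\mathbf{N}_u*\mathbf{N}_v=\mathbf{N}_{\mathrm{pack}\binom{u}{v}}$, where $\binom{u}{v}$ is the word of biletters $\binom{u_1}{v_1}\cdots\binom{u_n}{v_n}$, ordered lexicographically with priority to the top letter; scalars are extended to $\mathbb{K}[t]$. The degree $n$ component of $\sigma_1^t$ is $$(\sigma_1^t)_n=\sum_{|u|=n}\binom{t}{\max(u)}\mathbf{N}_u=\sum_{k=1}^n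 t^kE_n^{[k]},$$ the first sum being over all packed words of length $n$; the second equality defines $E_n^{[k]}$. For a packed word $u$ of length $n$, $\mathbf{K}_u:=\mathbf{N}_u*E_n^{[\max(u)]}$; the $\mathbf{K}_u$ form a basis of $\mathbf{WQSym}^*_n$. The $t$-Goldberg coefficients $c_u(t)$, $u$ packed, are the polynomials defined by $(e^{a_1}e^{a_2}\cdots)^t=\sum_u c_u(t)\mathbf{M}_u(A)$, where $a_1,a_2,\dots$ are noncommuting variables, $g=e^{a_1}e^{a_2}\cdots$ is viewed as a formal series of words, $g^t=\sum_{k\ge 0}\binom{t}{k}(g-1)^k$, and $\mathbf{M}_u(A)=\sum_{\mathrm{pack}(w)=u}w$ (so $c_u(t)$ is the coefficient in $g^t$ of any word $w$ with $\mathrm{pack}(w)=u$). *)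

theory Defs
  imports
    "HOL-Computational_Algebra.Polynomial"
    "HOL-Library.Poly_Mapping"
    "HOL-Library.Product_Lexorder"
begin

section \<open>Packed words\<close>

definition packed :: "nat list \<Rightarrow> bool" where
  "packed u \<longleftrightarrow> (\<exists>r. set u = {1..r})"

text \<open>The empty word is packed (with \<open>r = 0\<close>), and its maximum is \<open>0\<close>.\<close>

definition max_letter :: "nat list \<Rightarrow> nat" where
  "max_letter u = Max (insert 0 (set u))"

definition packed_words :: "nat \<Rightarrow> nat list set" where
  "packed_words n = {u. packed u \<and> length u = n}"

text \<open>If \<open>b\<^sub>1 < \<dots> < b\<^sub>r\<close> are the distinct letters of \<open>w\<close>, then \<open>i\<close> is the number of letters
  of \<open>w\<close> that are \<open>\<le> b\<^sub>i\<close>.\<close>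

definition pack :: "'b::linorder list \<Rightarrow> nat list" where
  "pack w = map (\<lambda>a. card {b \<in> set w. b \<le> a}) w"

definition WRef :: "nat list \<Rightarrow> nat list set" where
  "WRef v = {x \<in> packed_words (length v).
     \<forall>i<length v. \<forall>j<length v. x ! i = x ! j \<longrightarrow> v ! i = v ! j}"

definition refinement_word :: "nat list \<Rightarrow> nat list \<Rightarrow> nat list" where
  "refinement_word v x =
     map (\<lambda>i. v ! (SOME j. j < length x \<and> x ! j = i)) [1..<Suc (max_letter x)]"

section \<open>The space with basis \<open>N\<^sub>u\<close>\<close>

text \<open>A vector is given by its finitely supported family of coordinates on the \<open>N\<^sub>u\<close>;
  the component of degree \<open>n\<close> consists of the vectors supported on \<open>packed_words n\<close>.
  Extending scalars to \<open>\<bbbK>[t]\<close> means taking \<open>'a = 'k poly\<close>.\<close>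

type_synonym 'a wqsym = "nat list \<Rightarrow>\<^sub>0 'a"

definition basis_N :: "nat list \<Rightarrow> 'a::zero_neq_one wqsym" where
  "basis_N u = Poly_Mapping.single u 1"

definition scale :: "'a::mult_zero \<Rightarrow> 'a wqsym \<Rightarrow> 'a wqsym" where
  "scale c f = Poly_Mapping.map (\<lambda>a. c * a) f"

definition extend_scalars :: "'k::zero wqsym \<Rightarrow> 'k poly wqsym" where
  "extend_scalars f = Poly_Mapping.map (\<lambda>a. [:a:]) f"

text \<open>Biletters are pairs, ordered lexicographically with priority to the first component
  (the top letter). Components of different degrees have internal product \<open>0\<close>.\<close>

definition internal_product ::
    "'a::comm_semiring_1 wqsym \<Rightarrow> 'a wqsym \<Rightarrow> 'a wqsym"  (infixl \<open>\<star>\<close> 70) where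
  "f \<star> g = (\<Sum>u\<in>Poly_Mapping.keys f. \<Sum>v\<in>Poly_Mapping.keys g.
     if length u = length v
     then Poly_Mapping.single (pack (zip u v)) (Poly_Mapping.lookup f u * Poly_Mapping.lookup g v)
     else 0)"

text \<open>The polynomial \<open>t(t - 1)\<cdots>(t - k + 1) / k!\<close>; the library's \<open>gchoose\<close> is constrained to
  fields and thus not available at type \<open>'k poly\<close>.\<close>

definition t_choose :: "nat \<Rightarrow> 'k::field_char_0 poly" where
  "t_choose k = smult (1 / fact k) (\<Prod>i<k. [:0, 1:] - of_nat i)"

text \<open>The degree \<open>n\<close> component of \<open>\<sigma>\<^sub>1\<^sup>t\<close>.\<close>

definition sigma_t :: "nat \<Rightarrow> 'k::field_char_0 poly wqsym" where
  "sigma_t n = (\<Sum>u\<in>packed_words n. scale (t_choose (max_letter u)) (basis_N u))"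

text \<open>The coefficient of \<open>t\<^sup>k\<close> in \<open>sigma_t n\<close>. For \<open>n \<ge> 1\<close> the constant term vanishes, so that
  \<open>k\<close> runs effectively over \<open>1, \<dots>, n\<close>; for \<open>n = 0\<close> only \<open>k = 0\<close> contributes.\<close>

definition E :: "nat \<Rightarrow> nat \<Rightarrow> 'k::field_char_0 wqsym" where
  "E n k = Poly_Mapping.map (\<lambda>p. coeff p k) (sigma_t n)"

definition basis_K :: "nat list \<Rightarrow> 'k::field_char_0 wqsym" where
  "basis_K u = basis_N u \<star> E (length u) (max_letter u)"

section \<open>Noncommutative series and Goldberg coefficients\<close>

text \<open>A formal series in the noncommuting variables \<open>a\<^sub>1, a\<^sub>2, \<dots>\<close> is the function sending a word
  in the indices to its coefficient.\<close>

type_synonym 'a nc_series = "nat list \<Rightarrow> 'a"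

definition nc_one :: "'a::zero_neq_one nc_series" where
  "nc_one w = (if w = [] then 1 else 0)"

definition nc_minus :: "'a::minus nc_series \<Rightarrow> 'a nc_series \<Rightarrow> 'a nc_series" where
  "nc_minus f g w = f w - g w"

definition nc_mult :: "'a::semiring_0 nc_series \<Rightarrow> 'a nc_series \<Rightarrow> 'a nc_series" where
  "nc_mult f g w = (\<Sum>k\<le>length w. f (take k w) * g (drop k w))"

primrec nc_power :: "'a::semiring_1 nc_series \<Rightarrow> nat \<Rightarrow> 'a nc_series" where
  "nc_power f 0 = nc_one"
| "nc_power f (Suc k) = nc_mult f (nc_power f k)"

definition nc_var :: "nat \<Rightarrow> 'a::zero_neq_one nc_series" where
  "nc_var i w = (if w = [i] then 1 else 0)"

text \<open>For a series \<open>f\<close> without constant term, the words of length less than \<open>k\<close> have coefficient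
  \<open>0\<close> in \<open>f\<^sup>k\<close>, so the sums over all \<open>k\<close> below and in \<open>nc_tpower\<close> are coefficientwise finite.\<close>

definition nc_exp :: "'k::field_char_0 nc_series \<Rightarrow> 'k nc_series" where
  "nc_exp f w = Sum_any (\<lambda>k. nc_power f k w / fact k)"

text \<open>\<open>e\<^bsup>a\<^sub>1\<^esup> \<cdots> e\<^bsup>a\<^sub>N\<^esup>\<close>\<close>

primrec exp_prod :: "nat \<Rightarrow> 'k::field_char_0 nc_series" where
  "exp_prod 0 = nc_one"
| "exp_prod (Suc N) = nc_mult (exp_prod N) (nc_exp (nc_var (Suc N)))"

text \<open>The infinite product \<open>g = e\<^bsup>a\<^sub>1\<^esup> e\<^bsup>a\<^sub>2\<^esup> \<cdots>\<close>: the coefficient of \<open>w\<close> in \<open>exp_prod N\<close> does not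
  depend on \<open>N\<close> once \<open>N\<close> is at least every letter of \<open>w\<close>.\<close>

definition exp_series :: "'k::field_char_0 nc_series" where
  "exp_series w = (THE c. \<forall>\<^sub>F N in sequentially. exp_prod N w = c)"

text \<open>\<open>f\<^sup>t = \<Sum>\<^sub>k (t choose k) (f - 1)\<^sup>k\<close>, for \<open>f\<close> with constant term \<open>1\<close>\<close>

definition nc_tpower :: "'k::field_char_0 nc_series \<Rightarrow> 'k poly nc_series" where
  "nc_tpower f w = Sum_any (\<lambda>k. smult (nc_power (nc_minus f nc_one) k w) (t_choose k))"

text \<open>A packed word \<open>u\<close> satisfies \<open>pack u = u\<close>, so the coefficient of \<open>M\<^sub>u\<close> can be read off at \<open>u\<close>.\<close>

definition goldberg :: "nat list \<Rightarrow> 'k::field_char_0 poly" where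
  "goldberg u = nc_tpower exp_series u"

end

theory Submission
  imports Defs "HOL-Computational_Algebra.Formal_Power_Series"
begin

text \<open>Compare the coefficients of \<open>N\<^sub>y\<close>. Both vanish unless \<open>y\<close> is a weak refinement of \<open>v\<close>;
  if it is, put \<open>m = m(v, y)\<close>. On the left, \<open>N\<^sub>y\<close> comes from the words \<open>u\<close> that are constant on the
  positions of each letter of \<open>y\<close>, weakly increasing from one letter of \<open>y\<close> to the next, and strictly
  so wherever \<open>m\<close> does not increase; their sum is the coefficient of \<open>m\<close> in \<open>h\<^sup>t\<close>, where
  \<open>h = (1 + a\<^sub>1)(1 + a\<^sub>2)\<cdots>\<close>. On the right, \<open>K\<^sub>x\<close> contains \<open>N\<^sub>y\<close> only if \<open>x\<close> merges consecutive letters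
  of \<open>y\<close>. If the blocks of merged letters have sizes \<open>b\<^sub>1, b\<^sub>2, \<dots>\<close>, then \<open>N\<^sub>y\<close> has the coefficient
  \<open>\<Prod>\<^sub>i (t choose b\<^sub>i)\<close> in \<open>N\<^sub>x * \<sigma>\<^sub>1\<^sup>t\<close>, hence \<open>\<Prod>\<^sub>i (-1)\<^bsup>b\<^sub>i - 1\<^esup> / b\<^sub>i\<close> in \<open>K\<^sub>x\<close>. And \<open>x\<close> weakly
  refines \<open>v\<close> iff \<open>m\<close> is constant on each block. The sum over \<open>x\<close> is therefore the coefficient of
  \<open>m\<close> in the series obtained from \<open>g\<^sup>t\<close> by substituting \<open>log (1 + a\<^sub>i)\<close> for every \<open>a\<^sub>i\<close>, which maps
  \<open>g\<close> to \<open>h\<close>.\<close>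

section \<open>Relabelling packed words\<close>

lemma max_letter_eq: "set u = {1..r} \<Longrightarrow> max_letter u = r"
  unfolding max_letter_def by (rule Max_eqI) (auto simp: not_less_eq_eq)

lemma packed_iff: "packed u \<longleftrightarrow> set u = {1..max_letter u}"
proof
  assume "packed u"
  then obtain r where "set u = {1..r}" by (auto simp: packed_def)
  then show "set u = {1..max_letter u}" using max_letter_eq[of u r] by simp
qed (unfold packed_def, rule exI)

lemma finite_packed_words [simp]: "finite (packed_words n)"
proof (rule finite_subset)
  show "packed_words n \<subseteq> {u. set u \<subseteq> {..n} \<and> length u = n}"
  proof
    fix u assume u: "u \<in> packed_words n"
    then have s: "set u = {1..max_letter u}"
      by (simp add: packed_words_def packed_iff)
    then have "max_letter u = card (set u)" by simp
    then have "max_letter u \<le> n"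
      using card_length[of u] u by (simp add: packed_words_def)
    with s u show "u \<in> {u. set u \<subseteq> {..n} \<and> length u = n}"
      by (auto simp: packed_words_def)
  qed
  show "finite {u. set u \<subseteq> {..n} \<and> length u = n}"
    by (rule finite_lists_length_eq) simp
qed

text \<open>The letters of a packed word start at \<open>1\<close>, list positions at \<open>0\<close>.\<close>

definition relabel :: "nat list \<Rightarrow> 'b list \<Rightarrow> 'b list" where
  "relabel y s = map (\<lambda>j. s ! (j - 1)) y"

lemma length_relabel [simp]: "length (relabel y s) = length y"
  by (simp add: relabel_def)

lemma nth_relabel: "i < length y \<Longrightarrow> relabel y s ! i = s ! (y ! i - 1)"
  by (simp add: relabel_def)

lemma packed_nth:
  assumes "packed y" "i < length y"
  shows "1 \<le> y ! i" "y ! i \<le> max_letter y"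
proof -
  have "y ! i \<in> {1..max_letter y}"
    using assms(2) nth_mem[of i y] packed_iff[THEN iffD1, OF assms(1)] by simp
  then show "1 \<le> y ! i" "y ! i \<le> max_letter y" by auto
qed

lemma packed_nth_ex:
  assumes "packed y" "k < max_letter y"
  shows "\<exists>i<length y. y ! i = Suc k"
proof -
  have "Suc k \<in> set y" using assms by (simp add: packed_iff)
  then show ?thesis by (simp add: in_set_conv_nth)
qed

lemma set_relabel:
  assumes "packed y" "length s = max_letter y"
  shows "set (relabel y s) = set s"
proof -
  have "set (relabel y s) = (\<lambda>j. s ! (j - 1)) ` Suc ` {..<length s}"
    using assms by (simp add: relabel_def packed_iff image_Suc_lessThan)
  also have "\<dots> = (!) s ` {..<length s}" by (simp add: image_image)
  also have "\<dots> = set s" by (auto simp: in_set_conv_nth)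
  finally show ?thesis .
qed

lemma relabel_inject:
  assumes "packed y" "length s = max_letter y" "length s' = max_letter y"
  shows "relabel y s = relabel y s' \<longleftrightarrow> s = s'"
proof
  assume eq: "relabel y s = relabel y s'"
  show "s = s'"
  proof (rule nth_equalityI)
    fix k assume "k < length s"
    then obtain i where "i < length y" "y ! i = Suc k"
      using packed_nth_ex[OF assms(1), of k] assms(2) by auto
    then show "s ! k = s' ! k"
      using arg_cong[OF eq, of "\<lambda>w. w ! i"] by (simp add: nth_relabel)
  qed (use assms in simp)
qed simp

lemma relabel_zip:
  assumes "packed y" "length p = max_letter y" "length q = max_letter y"
  shows "relabel y (zip p q) = zip (relabel y p) (relabel y q)"
proof (rule nth_equalityI)
  fix i assume "i < length (relabel y (zip p q))"
  then have i: "i < length y" by simp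
  then have "y ! i - 1 < max_letter y"
    using packed_nth[OF assms(1) i] by simp
  with i assms show "relabel y (zip p q) ! i = zip (relabel y p) (relabel y q) ! i"
    by (simp add: nth_relabel)
qed simp

lemma relabel_relabel:
  assumes "packed y" "length c = max_letter y"
  shows "relabel y (relabel c m) = relabel (relabel y c) m"
proof (rule nth_equalityI)
  fix i assume "i < length (relabel y (relabel c m))"
  then have i: "i < length y" by simp
  then have "y ! i - 1 < length c"
    using packed_nth[OF assms(1) i] assms by simp
  with i show "relabel y (relabel c m) ! i = relabel (relabel y c) m ! i"
    by (simp add: nth_relabel)
qed simp

section \<open>Packing as the inverse of relabelling by a strictly increasing list\<close>

lemma card_le_nth_strict_sorted:
  fixes s :: "'b::linorder list"
  assumes "sorted_wrt (<) s" "i < length s"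
  shows "card {b \<in> set s. b \<le> s ! i} = Suc i"
proof -
  have "b \<le> s ! i \<longleftrightarrow> k \<le> i" if "b = s ! k" "k < length s" for b k
    using that assms(2) sorted_wrt_nth_less[OF assms(1), of i k] sorted_wrt_nth_less[OF assms(1), of k i]
    by (cases k i rule: linorder_cases) (auto simp: not_le)
  then have "{b \<in> set s. b \<le> s ! i} = (!) s ` {k. k \<le> i \<and> k < length s}"
    by (auto simp: set_conv_nth)
  also have "{k. k \<le> i \<and> k < length s} = {..i}" using assms(2) by auto
  finally have "{b \<in> set s. b \<le> s ! i} = (!) s ` {..i}" .
  moreover have "inj_on ((!) s) {..i}"
    using assms strict_sorted_iff[of s] by (auto simp: inj_on_def nth_eq_iff_index_eq)
  ultimately show ?thesis by (simp add: card_image)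
qed

lemma length_pack [simp]: "length (pack w) = length w"
  by (simp add: pack_def)

lemma set_pack:
  fixes w :: "'b::linorder list"
  shows "set (pack w) = {1..card (set w)}"
proof -
  define s where "s = sorted_list_of_set (set w)"
  have s: "sorted_wrt (<) s" "set s = set w" "length s = card (set w)"
    by (simp_all add: s_def)
  have "set (pack w) = (\<lambda>a. card {b \<in> set s. b \<le> a}) ` (!) s ` {..<length s}"
    by (auto simp: pack_def s(2)[symmetric] set_conv_nth[of s])
  also have "\<dots> = Suc ` {..<length s}"
    unfolding image_image by (intro image_cong refl) (simp add: card_le_nth_strict_sorted s(1))
  finally show ?thesis using s by (simp add: image_Suc_lessThan)
qed

lemma packed_pack: "packed (pack w)"
  using set_pack packed_def by blast

lemma max_letter_pack: "max_letter (pack w) = card (set w)"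
  by (rule max_letter_eq) (rule set_pack)

lemma pack_relabel:
  assumes "packed y" "length s = max_letter y" "sorted_wrt (<) s"
  shows "pack (relabel y s) = y"
proof (rule nth_equalityI)
  fix i assume "i < length (pack (relabel y s))"
  then have i: "i < length y" by simp
  have "pack (relabel y s) ! i = card {b \<in> set s. b \<le> s ! (y ! i - 1)}"
    using i unfolding pack_def set_relabel[OF assms(1,2)] by (simp add: nth_relabel)
  also have "\<dots> = y ! i"
    using packed_nth[OF assms(1) i] assms by (subst card_le_nth_strict_sorted) auto
  finally show "pack (relabel y s) ! i = y ! i" .
qed simp

lemma relabel_pack:
  fixes w :: "'b::linorder list"
  shows "relabel (pack w) (sorted_list_of_set (set w)) = w"
proof (rule nth_equalityI)
  define s where "s = sorted_list_of_set (set w)"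
  have s: "sorted_wrt (<) s" "set s = set w" by (simp_all add: s_def)
  fix i assume "i < length (relabel (pack w) (sorted_list_of_set (set w)))"
  then have i: "i < length w" by simp
  then have "w ! i \<in> set s" by (simp add: s)
  then obtain k where k: "k < length s" "s ! k = w ! i" by (auto simp: in_set_conv_nth)
  then have "pack w ! i = Suc k"
    using card_le_nth_strict_sorted[OF s(1) k(1)] i by (simp add: pack_def s)
  then show "relabel (pack w) (sorted_list_of_set (set w)) ! i = w ! i"
    using i k by (simp add: nth_relabel flip: s_def)
qed simp

text \<open>The list \<open>s\<close> consists of the distinct letters of \<open>w\<close> in
  increasing order. Packing, defined by counting, thus becomes the existence of an increasing
  relabelling.\<close>

lemma pack_eq_iff:
  fixes w :: "'b::linorder list"
  assumes "packed y"
  shows "pack w = y \<longleftrightarrow> (\<exists>s. length s = max_letter y \<and> sorted_wrt (<) s \<and> w = relabel y s)"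
proof
  assume "pack w = y"
  then show "\<exists>s. length s = max_letter y \<and> sorted_wrt (<) s \<and> w = relabel y s"
    using relabel_pack[of w] max_letter_pack[of w]
    by (intro exI[of _ "sorted_list_of_set (set w)"]) auto
next
  assume "\<exists>s. length s = max_letter y \<and> sorted_wrt (<) s \<and> w = relabel y s"
  then show "pack w = y" using pack_relabel[OF assms] by blast
qed

text \<open>Split the increasing list of biletters from \<open>pack_eq_iff\<close> into its two
  rows. This describes the terms of both products, \<open>sigma_t n \<star> basis_N v\<close> and
  \<open>basis_K x\<close>.\<close>

lemma pack_zip_eq_iff:
  fixes u :: "'b::linorder list" and v :: "'c::linorder list"
  assumes "packed y" "length u = length v"
  shows "pack (zip u v) = y \<longleftrightarrow> (\<exists>p q. length p = max_letter y \<and> length q = max_letter y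
    \<and> sorted_wrt (<) (zip p q) \<and> u = relabel y p \<and> v = relabel y q)" (is "?L \<longleftrightarrow> ?R")
proof
  assume ?L
  then obtain s where s: "length s = max_letter y" "sorted_wrt (<) s" "zip u v = relabel y s"
    using pack_eq_iff[OF assms(1), of "zip u v"] by blast
  have z: "s = zip (map fst s) (map snd s)" by (simp add: zip_map_fst_snd)
  have "zip u v = zip (relabel y (map fst s)) (relabel y (map snd s))"
    using s z relabel_zip[OF assms(1), of "map fst s" "map snd s"] by simp
  moreover have "length u = length y"
    using arg_cong[OF s(3), of length] assms(2) by simp
  ultimately have "u = relabel y (map fst s)" "v = relabel y (map snd s)"
    using assms(2) by (simp_all add: zip_eq_conv)
  then show ?R using s z by (intro exI[of _ "map fst s"] exI[of _ "map snd s"]) auto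
next
  assume ?R
  then obtain p q where pq: "length p = max_letter y" "length q = max_letter y"
    "sorted_wrt (<) (zip p q)" "u = relabel y p" "v = relabel y q" by blast
  then show ?L
    using pack_relabel[OF assms(1) _ pq(3)] relabel_zip[OF assms(1) pq(1,2)] by simp
qed

text \<open>The defining condition says that \<open>v\<close> is a function of the letters of
  \<open>x\<close>. Listing the values of this function gives \<open>m\<close>, which is the
  refinement word.\<close>

lemma WRef_iff:
  "x \<in> WRef v \<longleftrightarrow> packed x \<and> length x = length v \<and> (\<exists>m. length m = max_letter x \<and> v = relabel x m)"
proof
  assume x: "x \<in> WRef v"
  then have p: "packed x" "length x = length v" by (auto simp: WRef_def packed_words_def)
  have wref: "v ! i = v ! j" if "i < length v" "j < length v" "x ! i = x ! j" for i j
    using x that unfolding WRef_def by blast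
  \<comment> \<open>Some occurrence of the letter \<open>k + 1\<close> in \<open>x\<close>; by
    \<open>wref\<close> the letter of \<open>v\<close> found there does not depend on the
    choice.\<close>
  define pos where "pos k = (SOME i. i < length x \<and> x ! i = Suc k)" for k
  have pos: "pos k < length x \<and> x ! pos k = Suc k" if "k < max_letter x" for k
    unfolding pos_def by (rule someI_ex) (rule packed_nth_ex[OF p(1) that])
  define m where "m = map (\<lambda>k. v ! pos k) [0..<max_letter x]"
  have "v = relabel x m"
  proof (rule nth_equalityI)
    fix i assume i: "i < length v"
    then have k: "x ! i - 1 < max_letter x" "Suc (x ! i - 1) = x ! i"
      using packed_nth[OF p(1), of i] p(2) by auto
    then have "v ! pos (x ! i - 1) = v ! i"
      using pos[OF k(1)] i p(2) k(2) by (intro wref) simp_all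
    then show "v ! i = relabel x m ! i"
      using i p(2) k by (simp add: nth_relabel m_def)
  qed (use p in simp)
  then show "packed x \<and> length x = length v \<and> (\<exists>m. length m = max_letter x \<and> v = relabel x m)"
    using p by (intro conjI exI[of _ m]) (auto simp: m_def)
qed (auto simp: WRef_def packed_words_def nth_relabel)

lemma refinement_word_relabel:
  assumes "packed x" "length m = max_letter x"
  shows "refinement_word (relabel x m) x = m"
proof (rule nth_equalityI)
  fix k assume "k < length (refinement_word (relabel x m) x)"
  then have k: "k < max_letter x" by (simp add: refinement_word_def del: upt_Suc)
  define i where "i = (SOME j. j < length x \<and> x ! j = Suc k)"
  have "i < length x \<and> x ! i = Suc k"
    unfolding i_def by (rule someI_ex) (rule packed_nth_ex[OF assms(1) k])
  then show "refinement_word (relabel x m) x ! k = m ! k"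
    using k by (simp add: refinement_word_def nth_relabel flip: i_def del: upt_Suc)
qed (use assms in \<open>simp add: refinement_word_def del: upt_Suc\<close>)

section \<open>Binomial polynomials count strictly increasing words\<close>

lemma poly_t_choose: "poly (t_choose k) (of_nat N) = (of_nat (N choose k) :: 'k::field_char_0)"
  by (simp add: t_choose_def binomial_gbinomial gbinomial_prod_rev poly_prod atLeast0LessThan
      of_nat_poly)

text \<open>In characteristic 0 the natural numbers are infinitely many points, so identities
  between polynomials in \<open>t\<close> can be proved by counting.\<close>

lemma poly_eqI_of_nat:
  fixes p q :: "'k::field_char_0 poly"
  assumes "\<And>N. poly p (of_nat N) = poly q (of_nat N)"
  shows "p = q"
proof (rule ccontr)
  assume "p \<noteq> q"
  then have "finite {x. poly (p - q) x = 0}" by (intro poly_roots_finite) simp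
  moreover have "range of_nat \<subseteq> {x. poly (p - q) x = 0}" using assms by auto
  ultimately have "finite (range (of_nat :: nat \<Rightarrow> 'k))" by (rule finite_subset[rotated])
  then show False by (simp add: finite_image_iff inj_on_def)
qed

definition ascending_words :: "nat \<Rightarrow> nat \<Rightarrow> nat list set" where
  "ascending_words b N = {s. length s = b \<and> sorted_wrt (<) s \<and> set s \<subseteq> {1..N}}"

text \<open>A strictly increasing word is determined by its set of letters.\<close>

lemma card_ascending_words: "card (ascending_words b N) = N choose b"
proof -
  have "bij_betw set (ascending_words b N) {A. A \<subseteq> {1..N} \<and> card A = b}"
  proof (rule bij_betw_byWitness[where f' = sorted_list_of_set])
    show "\<forall>s\<in>ascending_words b N. sorted_list_of_set (set s) = s"
      by (auto simp: ascending_words_def strict_sorted_equal)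
    show "\<forall>A\<in>{A. A \<subseteq> {1..N} \<and> card A = b}. set (sorted_list_of_set A) = A"
      using finite_subset[of _ "{1..N}"] by auto
    show "set ` ascending_words b N \<subseteq> {A. A \<subseteq> {1..N} \<and> card A = b}"
      by (auto simp: ascending_words_def distinct_card strict_sorted_iff)
    show "sorted_list_of_set ` {A. A \<subseteq> {1..N} \<and> card A = b} \<subseteq> ascending_words b N"
      using finite_subset[of _ "{1..N}"] by (fastforce simp: ascending_words_def)
  qed
  then show ?thesis
    using bij_betw_same_card n_subsets[of "{1..N}" b] by fastforce
qed

text \<open>In lexicographic order the condition on \<open>zip c d\<close> means that
  \<open>c\<close> increases weakly and that \<open>d\<close> increases strictly on each run of
  equal letters of \<open>c\<close>.\<close>

definition ascending_above :: "nat list \<Rightarrow> nat \<Rightarrow> nat list set" where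
  "ascending_above c N =
     {d. length d = length c \<and> set d \<subseteq> {1..N} \<and> sorted_wrt (<) (zip c d)}"

text \<open>Only comparisons between letters of the bottom row matter, and a strictly increasing
  relabelling preserves them.\<close>

lemma sorted_zip_relabel_iff:
  fixes c :: "nat list" and s :: "nat list"
  assumes "packed u" "length u = length c" "length s = max_letter u" "sorted_wrt (<) s"
  shows "sorted_wrt (<) (zip c (relabel u s)) \<longleftrightarrow> sorted_wrt (<) (zip c u)"
proof -
  have "s ! (u ! i - 1) < s ! (u ! j - 1) \<longleftrightarrow> u ! i < u ! j"
    if "i < length u" "j < length u" for i j
  proof -
    have b: "1 \<le> u ! i" "u ! i \<le> length s" "1 \<le> u ! j" "u ! j \<le> length s"
      using packed_nth[OF assms(1)] that assms(3) by auto
    then have "u ! i < u ! j \<longleftrightarrow> u ! i - 1 < u ! j - 1" "u ! j < u ! i \<longleftrightarrow> u ! j - 1 < u ! i - 1"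
      "u ! i - 1 < length s" "u ! j - 1 < length s"
      by auto
    then show ?thesis
      using sorted_wrt_nth_less[OF assms(4), of "u ! i - 1" "u ! j - 1"]
        sorted_wrt_nth_less[OF assms(4), of "u ! j - 1" "u ! i - 1"]
      by (cases "u ! i" "u ! j" rule: linorder_cases) auto
  qed
  then show ?thesis
    using assms(2) by (auto simp: sorted_wrt_iff_nth_less nth_relabel)
qed

text \<open>Group the words on the right by their packed words. The class of \<open>u\<close>
  consists of its relabellings by strictly increasing words over \<open>{1..N}\<close>, and there
  are \<open>N choose max_letter u\<close> of these.\<close>

lemma sum_choose_eq_card_ascending_above:
  "(\<Sum>d | d \<in> packed_words (length c) \<and> sorted_wrt (<) (zip c d). N choose max_letter d)
    = card (ascending_above c N)" (is "sum _ ?P = _")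
proof -
  define F where "F u = relabel u ` ascending_words (max_letter u) N" for u :: "nat list"
  have P: "packed u" "length u = length c" "sorted_wrt (<) (zip c u)" if "u \<in> ?P" for u
    using that by (auto simp: packed_words_def)
  have pack_F: "pack w = u" if "u \<in> ?P" "w \<in> F u" for u w
    using that P(1)[OF that(1)] by (auto simp: F_def ascending_words_def intro!: pack_relabel)
  have card_F: "card (F u) = N choose max_letter u" if "u \<in> ?P" for u
  proof -
    have "inj_on (relabel u) (ascending_words (max_letter u) N)"
      using relabel_inject[OF P(1)[OF that]] by (auto simp: inj_on_def ascending_words_def)
    then show ?thesis by (simp add: F_def card_image card_ascending_words)
  qed
  have "ascending_above c N = (\<Union>u\<in>?P. F u)"
  proof (intro equalityI subsetI)
    fix d assume d: "d \<in> ascending_above c N"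
    define s where "s = sorted_list_of_set (set d)"
    have s: "length s = max_letter (pack d)" "sorted_wrt (<) s" "set s = set d" "d = relabel (pack d) s"
      using relabel_pack[of d] by (simp_all add: s_def max_letter_pack)
    have "sorted_wrt (<) (zip c (relabel (pack d) s))"
      using d s(4) by (simp add: ascending_above_def)
    then have "sorted_wrt (<) (zip c (pack d))"
      using sorted_zip_relabel_iff[OF packed_pack _ s(1,2)] d by (simp add: ascending_above_def)
    then have "pack d \<in> ?P"
      using d packed_pack[of d] by (simp add: packed_words_def ascending_above_def)
    moreover have "s \<in> ascending_words (max_letter (pack d)) N"
      using s d by (simp add: ascending_words_def ascending_above_def)
    ultimately show "d \<in> (\<Union>u\<in>?P. F u)" using s(4) unfolding F_def by blast
  next
    fix d assume "d \<in> (\<Union>u\<in>?P. F u)"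
    then obtain u s where u: "u \<in> ?P" and s: "s \<in> ascending_words (max_letter u) N"
      and d: "d = relabel u s" unfolding F_def by blast
    then show "d \<in> ascending_above c N"
      using P[OF u] sorted_zip_relabel_iff[OF P(1,2)[OF u], of s] set_relabel[OF P(1)[OF u], of s]
      by (simp add: ascending_above_def ascending_words_def)
  qed
  then have "card (ascending_above c N) = (\<Sum>u\<in>?P. card (F u))"
  proof (simp only:, intro card_UN_disjoint)
    show "\<forall>u\<in>?P. finite (F u)"
      by (auto simp: F_def ascending_words_def intro!: finite_imageI
          finite_subset[OF _ finite_lists_length_eq[of "{1..N}"]])
    show "\<forall>u\<in>?P. \<forall>u'\<in>?P. u \<noteq> u' \<longrightarrow> F u \<inter> F u' = {}"
      using pack_F by blast
  qed simp
  then show ?thesis using card_F by simp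
qed

section \<open>Block decompositions\<close>

definition expand :: "(nat \<times> 'b) list \<Rightarrow> 'b list" where
  "expand p = concat (map (\<lambda>(b, a). replicate b a) p)"

lemma expand_simps [simp]:
  "expand [] = []"
  "expand ((b, a) # p) = replicate b a @ expand p"
  "expand (p @ q) = expand p @ expand q"
  by (simp_all add: expand_def)

lemma map_expand: "map f (expand p) = expand (map (apsnd f) p)"
  by (induction p) auto

lemma set_expand: "set (expand p) = {a. \<exists>b>0. (b, a) \<in> set p}"
  by (induction p) (auto simp: expand_def)

lemma set_expand_pos:
  assumes "\<forall>(b, a)\<in>set p. 0 < b"
  shows "set (expand p) = snd ` set p"
  using assms by (force simp: set_expand)

text \<open>Between \<open>c\<close> and \<open>c'\<close> the top letters already decide every
  comparison, so the two bottom words can be chosen independently.\<close>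

lemma ascending_above_append:
  assumes "\<And>x y. x \<in> set c \<Longrightarrow> y \<in> set c' \<Longrightarrow> x < y"
  shows "card (ascending_above (c @ c') N) = card (ascending_above c N) * card (ascending_above c' N)"
proof -
  have cross: "x < y" if "x \<in> set (zip c d)" "y \<in> set (zip c' d')" for x y d d'
    using assms set_zip_leftD that by (cases x; cases y) (fastforce dest: set_zip_leftD)
  have "ascending_above (c @ c') N = (\<lambda>(d, d'). d @ d') ` (ascending_above c N \<times> ascending_above c' N)"
  proof (intro equalityI subsetI)
    fix w assume w: "w \<in> ascending_above (c @ c') N"
    define d d' where "d = take (length c) w" and "d' = drop (length c) w"
    have "w = d @ d'" "length d = length c" "length d' = length c'"
      using w by (auto simp: d_def d'_def ascending_above_def)
    then have "d \<in> ascending_above c N" "d' \<in> ascending_above c' N"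
      using w by (auto simp: ascending_above_def sorted_wrt_append)
    with \<open>w = d @ d'\<close> show "w \<in> (\<lambda>(d, d'). d @ d') ` (ascending_above c N \<times> ascending_above c' N)"
      by force
  next
    fix w assume "w \<in> (\<lambda>(d, d'). d @ d') ` (ascending_above c N \<times> ascending_above c' N)"
    then obtain d d' where w: "w = d @ d'"
      and "d \<in> ascending_above c N" "d' \<in> ascending_above c' N" by auto
    then show "w \<in> ascending_above (c @ c') N"
      using cross[of _ d _ d'] unfolding w ascending_above_def
      by (simp add: sorted_wrt_append)
  qed
  moreover have "inj_on (\<lambda>(d, d'). d @ d') (ascending_above c N \<times> ascending_above c' N)"
    by (auto simp: inj_on_def ascending_above_def)
  ultimately show ?thesis by (simp add: card_image card_cartesian_product)
qed

lemma ascending_above_replicate: "ascending_above (replicate b a) N = ascending_words b N"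
  by (auto simp: ascending_above_def ascending_words_def sorted_wrt_iff_nth_less)

lemma card_ascending_above_expand:
  assumes "sorted_wrt (<) (map snd p)"
  shows "card (ascending_above (expand p) N) = prod_list (map (\<lambda>(b, _). N choose b) p)"
  using assms
proof (induction p)
  case Nil
  have "ascending_above [] N = {[]}" by (auto simp: ascending_above_def)
  then show ?case by simp
next
  case (Cons ba p)
  obtain b a where ba: "ba = (b, a)" by (cases ba)
  have "card (ascending_above (replicate b a @ expand p) N)
      = card (ascending_above (replicate b a) N) * card (ascending_above (expand p) N)"
    using Cons.prems ba by (intro ascending_above_append) (force simp: set_expand)
  then show ?case
    using Cons ba by (simp add: ascending_above_replicate card_ascending_words)
qed

text \<open>At \<open>t = N\<close> both sides count \<open>ascending_above (expand p) N\<close>.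
  Later this evaluates the coefficient of \<open>N\<^sub>y\<close> in the product of
  \<open>N\<^sub>x\<close> with \<open>sigma_t n\<close>, where the \<open>b\<close> are the sizes
  of the merged blocks.\<close>

lemma sum_t_choose_expand:
  fixes p :: "(nat \<times> nat) list"
  assumes "sorted_wrt (<) (map snd p)"
  shows "(\<Sum>d | d \<in> packed_words (length (expand p)) \<and> sorted_wrt (<) (zip (expand p) d).
      t_choose (max_letter d) :: 'k::field_char_0 poly) = prod_list (map (\<lambda>(b, _). t_choose b) p)"
proof (rule poly_eqI_of_nat)
  fix N
  have "poly (prod_list (map (\<lambda>(b, _). t_choose b) p)) (of_nat N :: 'k)
      = of_nat (prod_list (map (\<lambda>(b, _). N choose b) p))"
    by (induction p) (auto simp: poly_t_choose)
  also have "\<dots> = of_nat (\<Sum>d | d \<in> packed_words (length (expand p)) \<and>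
      sorted_wrt (<) (zip (expand p) d). N choose max_letter d)"
    by (simp add: sum_choose_eq_card_ascending_above card_ascending_above_expand[OF assms])
  finally show "poly (\<Sum>d | d \<in> packed_words (length (expand p)) \<and> sorted_wrt (<) (zip (expand p) d).
      t_choose (max_letter d)) (of_nat N :: 'k) = poly (prod_list (map (\<lambda>(b, _). t_choose b) p)) (of_nat N)"
    by (simp add: poly_sum poly_t_choose)
qed

text \<open>The coefficient of \<open>X ^ b\<close> in log (1 + X). At \<open>b = 0\<close> division
  by zero yields 0, which agrees with the constant term.\<close>

definition log_coeff :: "nat \<Rightarrow> 'k::field_char_0" where
  "log_coeff b = (- 1) ^ (b - 1) / of_nat b"

text \<open>The factor for \<open>i = 0\<close> is \<open>t\<close>; the others multiply at
  \<open>t = 0\<close> to a signed factorial. Conceptually, the part of (1 + X)^t linear in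
  \<open>t\<close> is log (1 + X).\<close>

lemma t_choose_factor:
  assumes "0 < b"
  shows "\<exists>q. t_choose b = monom 1 1 * q \<and> poly q 0 = (log_coeff b :: 'k::field_char_0)"
proof -
  obtain a where b: "b = Suc a" using assms by (cases b) auto
  define q :: "'k poly" where "q = smult (1 / fact b) (\<Prod>i<a. [:0, 1:] - of_nat (Suc i))"
  have "t_choose b = monom 1 1 * q"
    unfolding t_choose_def b prod.lessThan_Suc_shift q_def
    by (simp add: monom_altdef del: of_nat_Suc)
  moreover have "(\<Prod>i<a. - of_nat (Suc i) :: 'k) = (- 1) ^ a * fact a"
    by (induction a) (simp_all add: algebra_simps)
  then have "poly q 0 = log_coeff b"
    by (simp add: q_def poly_prod b log_coeff_def field_simps of_nat_poly del: of_nat_Suc)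
  ultimately show ?thesis by blast
qed

text \<open>Each factor is divisible by \<open>t\<close>, so the coefficient of \<open>t\<close> to
  the number of factors is the product of the linear coefficients.\<close>

lemma coeff_prod_t_choose:
  assumes "\<And>b a. (b, a) \<in> set p \<Longrightarrow> 0 < b"
  shows "coeff (prod_list (map (\<lambda>(b, _). t_choose b) p)) (length p)
    = (prod_list (map (\<lambda>(b, _). log_coeff b) p) :: 'k::field_char_0)"
proof -
  have "\<exists>q. prod_list (map (\<lambda>(b, _). t_choose b) p) = monom 1 (length p) * q
      \<and> poly q 0 = (prod_list (map (\<lambda>(b, _). log_coeff b) p) :: 'k)"
    using assms
  proof (induction p)
    case Nil
    then show ?case by (intro exI[of _ 1]) (simp add: monom_0 one_pCons)
  next
    case (Cons ba p)
    obtain b a where ba: "ba = (b, a)" by (cases ba)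
    obtain q r where q: "prod_list (map (\<lambda>(b, _). t_choose b) p) = monom 1 (length p) * q"
        "poly q 0 = (prod_list (map (\<lambda>(b, _). log_coeff b) p) :: 'k)"
      and r: "t_choose b = monom 1 1 * r" "poly r 0 = (log_coeff b :: 'k)"
      using Cons t_choose_factor[of b] ba by fastforce
    have "monom 1 (Suc (length p)) = monom 1 1 * (monom 1 (length p) :: 'k poly)"
      by (simp add: mult_monom)
    then show ?case
      using q r ba by (intro exI[of _ "r * q"]) (simp add: mult_ac)
  qed
  then show ?thesis by (auto simp: coeff_monom_mult poly_0_coeff_0)
qed

section \<open>Recovering sorted words from the multiplicities of their letters\<close>

lemma count_list_expand_zip:
  assumes "length bs = length as" "distinct as"
  shows "map (count_list (expand (zip bs as))) as = bs"
proof -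
  have nin: "count_list (expand p) x = 0" if "x \<notin> snd ` set p" for p :: "(nat \<times> 'a) list" and x
    using that by (intro count_notin) (force simp: set_expand)
  have rep: "count_list (replicate b a) x = (if x = a then b else 0)" for b and a x :: 'a
    by (induction b) auto
  show ?thesis using assms
  proof (induction bs as rule: list_induct2)
    case (Cons b bs a as)
    have "a \<notin> snd ` set (zip bs as)"
      using Cons.prems by (auto dest: set_zip_rightD)
    then have "count_list (expand (zip bs as)) a = 0" by (rule nin)
    then have "count_list (expand (zip (b # bs) (a # as))) a = b"
      by (simp add: rep)
    moreover have "map (count_list (expand (zip (b # bs) (a # as)))) as
        = map (count_list (expand (zip bs as))) as"
      using Cons.prems by (intro map_cong) (auto simp: rep)
    ultimately show ?case using Cons by (simp only: list.map distinct.simps)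
  qed simp
qed

lemma sorted_expand:
  assumes "sorted (map snd p)"
  shows "sorted (expand p)"
  using assms by (induction p) (auto simp: sorted_append set_expand, force)

text \<open>Both sides are sorted and have the same multiset of letters. Letters of
  \<open>as\<close> missing from \<open>c\<close> give blocks of size 0.\<close>

lemma expand_count_list:
  fixes c :: "'b::linorder list"
  assumes "sorted c" "sorted_wrt (<) as" "set c \<subseteq> set as"
  shows "expand (zip (map (count_list c) as) as) = c" (is "?e = c")
proof -
  have as: "distinct as" "sorted as" using assms(2) by (auto simp: strict_sorted_iff)
  have counts: "map (count_list ?e) as = map (count_list c) as"
    using as(1) by (intro count_list_expand_zip) simp_all
  have sub: "set ?e \<subseteq> set as" by (auto simp: set_expand dest: set_zip_rightD)
  have "count_list ?e x = count_list c x" for x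
  proof (cases "x \<in> set as")
    case True
    then show ?thesis using counts by auto
  next
    case False
    then show ?thesis using sub assms(3) by (metis count_notin subsetD)
  qed
  then have "mset ?e = mset c" by (intro multiset_eqI) (simp add: count_mset)
  moreover have "sorted ?e" using as by (intro sorted_expand) simp
  ultimately show ?thesis using assms(1) properties_for_sort by metis
qed

section \<open>Substituting \<open>log (1 + a\<^sub>i)\<close> for \<open>a\<^sub>i\<close>\<close>

text \<open>Consecutive blocks may carry the same letter, so a run of equal letters can be split in
  several ways.\<close>

definition block_decomps :: "'b list \<Rightarrow> (nat \<times> 'b) list set" where
  "block_decomps m = {p. (\<forall>(b, a)\<in>set p. 0 < b) \<and> expand p = m}"

definition log_weight :: "(nat \<times> 'b) list \<Rightarrow> 'k::field_char_0" where
  "log_weight p = prod_list (map (\<lambda>(b, _). log_coeff b) p)"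

text \<open>The substitution of log (1 + \<open>a\<^sub>i\<close>) for \<open>a\<^sub>i\<close>: the
  word \<open>map snd p\<close> becomes a product of logarithms, and choosing the power
  \<open>b\<close> of each letter \<open>a\<close> from its factor yields the word
  \<open>expand p\<close>.\<close>

definition log_subst :: "'k::field_char_0 nc_series \<Rightarrow> 'k nc_series" where
  "log_subst f m = (\<Sum>p\<in>block_decomps m. f (map snd p) * log_weight p)"

lemma length_expand: "length (expand p) = sum_list (map fst p)"
  by (induction p) auto

lemma length_block_decomps:
  assumes "p \<in> block_decomps m"
  shows "length p \<le> length m"
proof -
  have "length p \<le> sum_list (map fst p)" if "\<forall>(b, a)\<in>set p. 0 < b" for p :: "(nat \<times> 'a) list"
    using that by (induction p) auto
  then show ?thesis
    using assms length_expand[of p] by (auto simp: block_decomps_def)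
qed

lemma set_block_decomps:
  assumes "p \<in> block_decomps m"
  shows "set (map snd p) = set m"
  using assms by (auto simp: block_decomps_def set_expand_pos[symmetric])

lemma finite_block_decomps [simp]: "finite (block_decomps m)"
proof (rule finite_subset)
  show "block_decomps m \<subseteq> {p. set p \<subseteq> {..length m} \<times> set m \<and> length p \<le> length m}"
  proof
    fix p assume p: "p \<in> block_decomps m"
    have "b \<le> length m \<and> a \<in> set m" if "(b, a) \<in> set p" for b a
    proof
      have "b \<le> sum_list (map fst p)"
        using that by (intro member_le_sum_list) (force simp: image_iff)+
      then show "b \<le> length m"
        using p length_expand[of p] by (simp add: block_decomps_def)
      show "a \<in> set m" using that set_block_decomps[OF p] by force
    qed
    then show "p \<in> {p. set p \<subseteq> {..length m} \<times> set m \<and> length p \<le> length m}"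
      using length_block_decomps[OF p] by auto
  qed
  show "finite {p. set p \<subseteq> {..length m} \<times> set m \<and> length p \<le> length m}"
    by (rule finite_lists_length_le) simp
qed

lemma log_weight_append: "log_weight (p @ q) = log_weight p * log_weight q"
  by (simp add: log_weight_def)

text \<open>A decomposition of \<open>m\<close> cut between two blocks is the same as a cut of
  \<open>m\<close> together with a decomposition of each part. The bijection converts the cut
  position from a number of blocks to a number of letters.\<close>

lemma log_subst_mult: "log_subst (nc_mult f g) = nc_mult (log_subst f) (log_subst g)"
proof
  fix m
  have "log_subst (nc_mult f g) m = (\<Sum>(p, k)\<in>Sigma (block_decomps m) (\<lambda>p. {..length p}).
      f (take k (map snd p)) * g (drop k (map snd p)) * log_weight p)"
    by (simp add: log_subst_def nc_mult_def sum_distrib_right sum.Sigma)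
  also have "\<dots> = (\<Sum>(j, p, q)\<in>Sigma {..length m} (\<lambda>j. block_decomps (take j m) \<times> block_decomps (drop j m)).
      (f (map snd p) * log_weight p) * (g (map snd q) * log_weight q))"
  proof (rule sum.reindex_bij_witness[where j = "\<lambda>(p, k). (length (expand (take k p)), take k p, drop k p)"
      and i = "\<lambda>(j, p, q). (p @ q, length p)"], goal_cases)
    case (2 x)
    obtain p k where x: "x = (p, k)" by (cases x)
    have e: "expand (take k p) @ expand (drop k p) = m"
      using 2 x expand_simps(3)[of "take k p" "drop k p"] by (simp add: block_decomps_def)
    show ?case
      using 2 by (auto simp: x block_decomps_def dest: in_set_takeD in_set_dropD simp flip: e)
  next
    case (5 x)
    obtain p k where x: "x = (p, k)" by (cases x)
    have "log_weight p = log_weight (take k p) * (log_weight (drop k p) :: 'a)"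
      using log_weight_append[of "take k p" "drop k p"] by simp
    then show ?case by (simp add: x take_map drop_map mult_ac)
  qed (auto simp: block_decomps_def min_def)
  also have "\<dots> = nc_mult (log_subst f) (log_subst g) m"
    by (simp add: log_subst_def nc_mult_def sum_product sum.cartesian_product sum.Sigma split_def)
  finally show "log_subst (nc_mult f g) m = nc_mult (log_subst f) (log_subst g) m" .
qed

lemma Nil_block_decomps: "[] \<in> block_decomps m \<longleftrightarrow> m = []"
  by (auto simp: block_decomps_def)

lemma log_subst_one: "log_subst nc_one = (nc_one :: 'k::field_char_0 nc_series)"
proof
  fix m
  have "log_subst nc_one m = (\<Sum>p\<in>block_decomps m. if p = [] then 1 else 0 :: 'k)"
    unfolding log_subst_def by (intro sum.cong) (auto simp: nc_one_def log_weight_def)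
  then show "log_subst nc_one m = (nc_one m :: 'k)"
    by (simp add: Nil_block_decomps nc_one_def)
qed

lemma log_subst_minus: "log_subst (nc_minus f g) = nc_minus (log_subst f) (log_subst g)"
  by (auto simp: log_subst_def nc_minus_def left_diff_distrib sum_subtractf)

lemma log_subst_power: "log_subst (nc_power f k) = nc_power (log_subst f) k"
  by (induction k) (simp_all add: log_subst_one log_subst_mult)

section \<open>Series in one variable\<close>

text \<open>The power series \<open>\<phi>\<close> evaluated at the variable
  \<open>a\<^sub>i\<close>; the words with \<open>set w \<subseteq> {i}\<close> are its powers. This
  moves computations with one variable to ordinary power series.\<close>

definition fps_in_var :: "nat \<Rightarrow> 'k::field_char_0 fps \<Rightarrow> 'k nc_series" where
  "fps_in_var i \<phi> w = (if set w \<subseteq> {i} then fps_nth \<phi> (length w) else 0)"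

lemma fps_in_var_mult: "nc_mult (fps_in_var i \<phi>) (fps_in_var i \<psi>) = fps_in_var i (\<phi> * \<psi>)"
proof
  fix w
  show "nc_mult (fps_in_var i \<phi>) (fps_in_var i \<psi>) w = fps_in_var i (\<phi> * \<psi>) w"
  proof (cases "set w \<subseteq> {i}")
    case True
    then have "set (take k w) \<subseteq> {i} \<and> set (drop k w) \<subseteq> {i}" for k
      by (auto dest: in_set_takeD in_set_dropD)
    then show ?thesis
      using True by (simp add: nc_mult_def fps_in_var_def fps_mult_nth atLeast0AtMost)
  next
    case False
    then have "\<not> set (take k w) \<subseteq> {i} \<or> \<not> set (drop k w) \<subseteq> {i}" for k
      using set_append[of "take k w" "drop k w"] by auto
    then show ?thesis
      using False by (auto simp: nc_mult_def fps_in_var_def intro!: sum.neutral)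
  qed
qed

lemma fps_in_var_power: "nc_power (fps_in_var i \<phi>) k = fps_in_var i (\<phi> ^ k)"
proof (induction k)
  case 0
  show ?case by (auto simp: nc_one_def fps_in_var_def)
qed (simp add: fps_in_var_mult)

lemma nc_var_eq_fps: "nc_var i = fps_in_var i fps_X"
proof
  fix w show "nc_var i w = fps_in_var i fps_X w"
    by (cases w rule: list.exhaust[case_product list.exhaust[of "tl w"]])
      (auto simp: nc_var_def fps_in_var_def)
qed

text \<open>Only a decomposition into a single block can spell the word \<open>[i]\<close>, and its
  weight is a coefficient of \<open>fps_ln 1\<close>, which is log (1 + X).\<close>

lemma log_subst_var: "log_subst (nc_var i) = (fps_in_var i (fps_ln 1) :: 'k::field_char_0 nc_series)"
proof
  fix m
  have p: "p = [(length m, i)]" if p: "p \<in> block_decomps m" "map snd p = [i]" for p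
  proof -
    have "p = [(fst (hd p), i)]" using p(2) by (cases p) auto
    moreover have "expand p = m" using p(1) by (simp add: block_decomps_def)
    ultimately have "length m = fst (hd p)"
      by (metis append_Nil2 expand_simps(1,2) length_replicate)
    then show ?thesis using \<open>p = [(fst (hd p), i)]\<close> by simp
  qed
  show "log_subst (nc_var i) m = (fps_in_var i (fps_ln 1) m :: 'k)"
  proof (cases "m \<noteq> [] \<and> set m \<subseteq> {i}")
    case True
    then have "replicate (length m) i = m"
      by (intro replicate_length_same) auto
    then have "[(length m, i)] \<in> block_decomps m"
      using True by (simp add: block_decomps_def)
    moreover have "log_subst (nc_var i) m
        = (\<Sum>p\<in>block_decomps m. if p = [(length m, i)] then log_coeff (length m) else (0 :: 'k))"
      unfolding log_subst_def
    proof (intro sum.cong refl)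
      fix p assume "p \<in> block_decomps m"
      then show "nc_var i (map snd p) * log_weight p
          = (if p = [(length m, i)] then log_coeff (length m) else (0 :: 'k))"
        using p[of p] by (cases "map snd p = [i]") (auto simp: nc_var_def log_weight_def)
    qed
    ultimately show ?thesis
      using True by (simp add: fps_in_var_def fps_ln_nth log_coeff_def)
  next
    case False
    have "map snd p \<noteq> [i]" if "p \<in> block_decomps m" for p
      using set_block_decomps[OF that] False by auto
    then have "log_subst (nc_var i) m = (0 :: 'k)"
      unfolding log_subst_def by (intro sum.neutral) (auto simp: nc_var_def)
    then show ?thesis using False by (auto simp: fps_in_var_def)
  qed
qed

section \<open>Truncating the exponential and the binomial series\<close>

lemma nc_power_eq_0:
  assumes "f [] = 0" "length w < k"
  shows "nc_power f k w = 0"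
  using assms(2)
proof (induction k arbitrary: w)
  case (Suc k)
  have "f (take j w) * nc_power f k (drop j w) = 0" if "j \<le> length w" for j
    using that Suc assms(1) by (cases "j = 0") auto
  then show ?case by (simp add: nc_mult_def)
qed simp

text \<open>The bound \<open>n\<close> is left free so that one range of summation serves all words
  of length at most \<open>n\<close>.\<close>

lemma nc_exp_eq_sum:
  assumes "f [] = 0" "length w \<le> n"
  shows "nc_exp f w = (\<Sum>k\<le>n. nc_power f k w / fact k)"
  unfolding nc_exp_def
proof (rule Sum_any.expand_superset)
  show "{k. nc_power f k w / fact k \<noteq> 0} \<subseteq> {..n}"
    using nc_power_eq_0[of f w] assms by (force simp: not_less)
qed simp

lemma nc_tpower_eq_sum:
  assumes "f [] = 1" "length w \<le> n"
  shows "nc_tpower f w = (\<Sum>k\<le>n. smult (nc_power (nc_minus f nc_one) k w) (t_choose k))"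
  unfolding nc_tpower_def
proof (rule Sum_any.expand_superset)
  show "{k. smult (nc_power (nc_minus f nc_one) k w) (t_choose k) \<noteq> 0} \<subseteq> {..n}"
    using nc_power_eq_0[of "nc_minus f nc_one" w] assms
    by (force simp: not_less nc_minus_def nc_one_def)
qed simp

lemma fps_exp_compose_ln: "fps_exp (1 :: 'k::field_char_0) oo fps_ln 1 = 1 + fps_X"
proof -
  have "(fps_exp 1 - 1) oo fps_ln (1 :: 'k) = fps_X"
    unfolding fps_ln_fps_exp_inv[OF one_neq_zero] by (intro fps_inv_right) simp_all
  then show ?thesis by (simp add: fps_compose_sub_distrib algebra_simps)
qed

text \<open>The substitution commutes with powers, which leaves the identity exp (log (1 + X)) = 1 +
  X in one variable.\<close>

lemma log_subst_exp_var:
  "log_subst (nc_exp (nc_var i)) = (fps_in_var i (1 + fps_X) :: 'k::field_char_0 nc_series)"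
proof
  fix m
  have "log_subst (nc_exp (nc_var i)) m = (\<Sum>p\<in>block_decomps m. \<Sum>k\<le>length m.
      nc_power (nc_var i) k (map snd p) / fact k * log_weight p :: 'k)"
    unfolding log_subst_def
    using length_block_decomps
    by (intro sum.cong refl, subst nc_exp_eq_sum) (auto simp: nc_var_def sum_distrib_right)
  also have "\<dots> = (\<Sum>k\<le>length m. log_subst (nc_power (nc_var i) k) m / fact k)"
    by (subst sum.swap) (simp add: log_subst_def sum_divide_distrib)
  also have "\<dots> = fps_in_var i (fps_exp 1 oo fps_ln 1) m"
    by (simp add: log_subst_power log_subst_var fps_in_var_power fps_in_var_def
        fps_compose_nth atLeast0AtMost)
  finally show "log_subst (nc_exp (nc_var i)) m = (fps_in_var i (1 + fps_X) m :: 'k)"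
    by (simp add: fps_exp_compose_ln)
qed

section \<open>The product of the \<open>1 + a\<^sub>i\<close>\<close>

text \<open>The product \<open>(1 + a\<^sub>1)\<cdots>(1 + a\<^sub>M)\<close> multiplied out: each
  strictly increasing word over \<open>{1..M}\<close> arises exactly once.\<close>

definition ascending_series :: "nat \<Rightarrow> 'k::field_char_0 nc_series" where
  "ascending_series M w = (if sorted_wrt (<) w \<and> set w \<subseteq> {1..M} then 1 else 0)"

text \<open>The new factor supplies the empty word or the single letter \<open>Suc M\<close>, so
  only the cuts at the end of \<open>w\<close> and just before its last letter contribute.\<close>

lemma ascending_series_Suc:
  "nc_mult (ascending_series M) (fps_in_var (Suc M) (1 + fps_X)) = ascending_series (Suc M)"
proof
  fix w
  have f: "fps_in_var (Suc M) (1 + fps_X) v = (if v = [] \<or> v = [Suc M] then 1 else 0 :: 'a)" for v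
    by (cases v rule: list.exhaust[case_product list.exhaust[of "tl v"]]) (auto simp: fps_in_var_def)
  show "nc_mult (ascending_series M) (fps_in_var (Suc M) (1 + fps_X)) w = (ascending_series (Suc M) w :: 'a)"
  proof (cases w rule: rev_cases)
    case Nil
    then show ?thesis by (simp add: nc_mult_def f ascending_series_def)
  next
    case (snoc v a)
    have z: "drop k w \<noteq> [] \<and> drop k w \<noteq> [Suc M]" if "k < length v" for k
      using that snoc arg_cong[of "drop k w" "[Suc M]" length] by auto
    have "nc_mult (ascending_series M) (fps_in_var (Suc M) (1 + fps_X)) w
        = (\<Sum>k<length v. ascending_series M (take k w) * fps_in_var (Suc M) (1 + fps_X) (drop k w))
          + ascending_series M v * fps_in_var (Suc M) (1 + fps_X) [a] + (ascending_series M w :: 'a)"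
      by (simp add: nc_mult_def snoc f lessThan_Suc_atMost[symmetric])
    also have "(\<Sum>k<length v. ascending_series M (take k w) * fps_in_var (Suc M) (1 + fps_X) (drop k w))
        = (0 :: 'a)"
      using z by (intro sum.neutral) (simp add: f)
    also have "0 + ascending_series M v * fps_in_var (Suc M) (1 + fps_X) [a] + ascending_series M w
        = (ascending_series (Suc M) w :: 'a)"
      by (fastforce simp: snoc f ascending_series_def sorted_wrt_append)
    finally show ?thesis .
  qed
qed

lemma log_subst_exp_prod:
  "log_subst (exp_prod M) = (ascending_series M :: 'k::field_char_0 nc_series)"
proof (induction M)
  case 0
  have "ascending_series 0 = (nc_one :: 'k nc_series)"
    by (auto simp: nc_one_def ascending_series_def)
  then show ?case by (simp add: log_subst_one)
next
  case (Suc M)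
  then show ?case by (simp add: log_subst_mult log_subst_exp_var ascending_series_Suc)
qed

section \<open>The infinite product of exponentials\<close>

lemma nc_exp_var_Nil: "nc_exp (nc_var i) [] = 1"
  by (subst nc_exp_eq_sum[where n = 0]) (simp_all add: nc_var_def nc_one_def)

lemma nc_exp_var_eq_0:
  assumes "\<not> set w \<subseteq> {i}"
  shows "nc_exp (nc_var i) w = 0"
  using assms by (subst nc_exp_eq_sum[OF _ order_refl])
    (simp_all add: nc_var_def[of _ "[]"] nc_var_eq_fps[of i] fps_in_var_power fps_in_var_def)

text \<open>A word without the letter \<open>Suc N\<close> can take only the constant term 1 from
  the last factor.\<close>

lemma exp_prod_Suc_eq:
  assumes "Suc N \<notin> set w"
  shows "exp_prod (Suc N) w = (exp_prod N w :: 'k::field_char_0)"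
proof -
  have "exp_prod N (take k w) * nc_exp (nc_var (Suc N)) (drop k w) = (0 :: 'k)" if "k < length w" for k
  proof -
    have "hd (drop k w) \<in> set (drop k w)" using that by (intro hd_in_set) simp
    moreover have "Suc N \<notin> set (drop k w)" using assms by (meson in_set_dropD)
    ultimately show ?thesis by (subst nc_exp_var_eq_0) auto
  qed
  then have "(\<Sum>k<length w. exp_prod N (take k w) * nc_exp (nc_var (Suc N)) (drop k w)) = (0 :: 'k)"
    by (intro sum.neutral) simp
  then show ?thesis
    by (simp add: nc_mult_def nc_exp_var_Nil lessThan_Suc_atMost[symmetric])
qed

lemma exp_prod_Nil: "exp_prod M [] = 1"
  by (induction M) (simp_all add: nc_one_def exp_prod_Suc_eq del: exp_prod.simps(2))

lemma exp_series_eq_exp_prod: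
  assumes "set w \<subseteq> {..M}"
  shows "exp_series w = (exp_prod M w :: 'k::field_char_0)"
proof -
  have ev: "exp_prod N w = (exp_prod M w :: 'k)" if "M \<le> N" for N
    using that
  proof (induction N rule: dec_induct)
    case (step N)
    then have "Suc N \<notin> set w" using assms by auto
    then show ?case using step exp_prod_Suc_eq by metis
  qed simp
  show ?thesis unfolding exp_series_def
  proof (rule the_equality)
    show "\<forall>\<^sub>F N in sequentially. exp_prod N w = (exp_prod M w :: 'k)"
      unfolding eventually_sequentially by (intro exI[of _ M] allI impI ev)
    fix c assume "\<forall>\<^sub>F N in sequentially. exp_prod N w = (c :: 'k)"
    then obtain N0 where "\<forall>N\<ge>N0. exp_prod N w = c"
      unfolding eventually_sequentially by blast
    then have "exp_prod (max N0 M) w = c" by simp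
    then show "c = exp_prod M w" using ev[of "max N0 M"] by simp
  qed
qed

text \<open>All factors of a word over \<open>A\<close> are words over \<open>A\<close>. With
  \<open>A = {..M}\<close> the infinite product of exponentials may be replaced by a finite
  one.\<close>

lemma nc_power_cong:
  assumes "\<And>v. set v \<subseteq> A \<Longrightarrow> f v = g v" "set w \<subseteq> A"
  shows "nc_power f k w = nc_power g k w"
  using assms(2)
proof (induction k arbitrary: w)
  case (Suc k)
  have "set (take j w) \<subseteq> A" "set (drop j w) \<subseteq> A" for j
    using Suc.prems by (auto dest: in_set_takeD in_set_dropD)
  then show ?case using Suc.IH assms(1) by (simp add: nc_mult_def)
qed simp

lemma goldberg_eq_sum:
  assumes "set w \<subseteq> {..M}" "length w \<le> n"
  shows "goldberg w = (\<Sum>k\<le>n. smult (nc_power (nc_minus (exp_prod M) nc_one) k w)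
    (t_choose k :: 'k::field_char_0 poly))"
proof -
  have "nc_power (nc_minus exp_series nc_one) k w
      = (nc_power (nc_minus (exp_prod M) nc_one) k w :: 'k)" for k
    using assms(1) by (intro nc_power_cong[of "{..M}"]) (simp_all add: nc_minus_def exp_series_eq_exp_prod)
  moreover have "exp_series [] = (1 :: 'k)"
    using exp_series_eq_exp_prod[of "[]" 0, where 'k = 'k] exp_prod_Nil[of 0, where 'a = 'k] by simp
  ultimately show ?thesis
    using assms(2) by (simp add: goldberg_def nc_tpower_eq_sum)
qed

text \<open>After exchanging the sums, \<open>t_choose k\<close> is multiplied by the coefficient of
  \<open>m\<close> in the substituted power \<open>k\<close> of \<open>exp_prod M - 1\<close>, and
  the substitution turns \<open>exp_prod M\<close> into \<open>ascending_series M\<close>.\<close>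

lemma sum_goldberg_block_decomps:
  assumes "set m \<subseteq> {..M}"
  shows "(\<Sum>p\<in>block_decomps m. goldberg (map snd p) * [:log_weight p:])
    = (\<Sum>k\<le>length m. smult (nc_power (nc_minus (ascending_series M) nc_one) k m)
        (t_choose k :: 'k::field_char_0 poly))"
proof -
  let ?f = "nc_minus (exp_prod M) nc_one :: 'k nc_series"
  have "(\<Sum>p\<in>block_decomps m. goldberg (map snd p) * [:log_weight p:])
      = (\<Sum>p\<in>block_decomps m. \<Sum>k\<le>length m. smult (nc_power ?f k (map snd p) * log_weight p) (t_choose k))"
  proof (intro sum.cong refl)
    fix p assume p: "p \<in> block_decomps m"
    have eq: "goldberg (map snd p) = (\<Sum>k\<le>length m. smult (nc_power ?f k (map snd p)) (t_choose k))"
      using set_block_decomps[OF p] length_block_decomps[OF p] assms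
      by (intro goldberg_eq_sum) simp_all
    show "goldberg (map snd p) * [:log_weight p:]
        = (\<Sum>k\<le>length m. smult (nc_power ?f k (map snd p) * log_weight p) (t_choose k))"
      unfolding eq sum_distrib_right by (simp add: mult.commute)
  qed
  also have "\<dots> = (\<Sum>k\<le>length m. smult (log_subst (nc_power ?f k) m) (t_choose k))"
    by (subst sum.swap) (simp add: log_subst_def smult_sum)
  finally show ?thesis
    by (simp add: log_subst_power log_subst_minus log_subst_one log_subst_exp_prod)
qed

section \<open>Powers of the product of the \<open>1 + a\<^sub>i\<close>\<close>

text \<open>These words encode the cuts of \<open>m\<close> into \<open>k\<close> nonempty strictly
  increasing factors: \<open>d\<close> repeats the index of each factor along it. The offset
  \<open>j\<close> lets an induction remove the first factor without renumbering.\<close>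

definition ascending_below :: "nat \<Rightarrow> nat \<Rightarrow> nat list \<Rightarrow> nat list set" where
  "ascending_below j k m =
     {d. length d = length m \<and> set d = {j<..j + k} \<and> sorted_wrt (<) (zip d m)}"

lemma finite_ascending_below [simp]: "finite (ascending_below j k m)"
  by (rule finite_subset[OF _ finite_lists_length_eq[of "{j<..j + k}" "length m"]])
    (auto simp: ascending_below_def)

lemma sorted_wrt_zip_fst:
  fixes c :: "'a::linorder list" and d :: "'b::linorder list"
  assumes "sorted_wrt (<) (zip c d)" "length c = length d"
  shows "sorted c"
  using assms by (fastforce simp: sorted_wrt_iff_nth_less)

text \<open>The smallest letter \<open>Suc j\<close> fills a nonempty prefix of \<open>d\<close>, on
  which \<open>m\<close> has to increase strictly; the rest of \<open>d\<close> uses the remaining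
  \<open>k\<close> letters.\<close>

lemma ascending_below_Suc:
  "ascending_below j (Suc k) m = (\<Union>b\<in>{b\<in>{1..length m}. sorted_wrt (<) (take b m)}.
     (\<lambda>d. replicate b (Suc j) @ d) ` ascending_below (Suc j) k (drop b m))"
proof (intro equalityI subsetI)
  fix d assume d: "d \<in> ascending_below j (Suc k) m"
  define as where "as = [Suc (Suc j)..<Suc (j + Suc k)]"
  define b where "b = count_list d (Suc j)"
  define e where "e = expand (zip (map (count_list d) as) as)"
  have len: "length d = length m" and set_d: "set d = {j<..j + Suc k}"
    and s: "sorted_wrt (<) (zip d m)" using d by (auto simp: ascending_below_def)
  have as: "[Suc j..<Suc (j + Suc k)] = Suc j # as"
    unfolding as_def by (rule upt_conv_Cons) simp
  \<comment> \<open>The top row \<open>d\<close> is sorted, hence determined by its multiplicities;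
    its first block consists of the letters \<open>Suc j\<close>.\<close>
  have "expand (zip (map (count_list d) [Suc j..<Suc (j + Suc k)]) [Suc j..<Suc (j + Suc k)]) = d"
    using sorted_wrt_zip_fst[OF s len] set_d
    by (intro expand_count_list sorted_wrt_upt) (auto simp del: upt_Suc)
  then have d_eq: "d = replicate b (Suc j) @ e" by (simp only: as list.map zip_Cons_Cons expand_simps b_def e_def)
  have e_sub: "set e \<subseteq> set as" by (auto simp: e_def set_expand dest: set_zip_rightD)
  have b: "0 < b"
    using set_d count_list_0_iff[of d "Suc j"] by (cases b) (simp_all add: b_def)
  have "set d = insert (Suc j) (set e)"
    using b arg_cong[OF d_eq, of set] by simp
  moreover have "Suc j \<notin> set e" using e_sub by (auto simp: as_def)
  ultimately have "set e = {j<..j + Suc k} - {Suc j}" using set_d by blast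
  also have "{j<..j + Suc k} - {Suc j} = {Suc j<..Suc j + k}" by auto
  finally have set_e: "set e = {Suc j<..Suc j + k}" .
  have zip: "zip d m = zip (replicate b (Suc j)) (take b m) @ zip e (drop b m)"
    using arg_cong[OF d_eq, of "\<lambda>d. zip d m"] by (simp add: zip_append1)
  have e: "e \<in> ascending_below (Suc j) k (drop b m)"
    using s len set_e zip arg_cong[OF d_eq, of length] by (simp add: ascending_below_def sorted_wrt_append)
  have bm: "b \<le> length m" using len arg_cong[OF d_eq, of length] by simp
  have sorted_take: "sorted_wrt (<) (take b m)"
  proof -
    have "sorted_wrt (<) (zip (replicate b (Suc j)) (take b m))"
      using s unfolding zip by (simp add: sorted_wrt_append)
    then show ?thesis using bm by (simp add: sorted_wrt_iff_nth_less)
  qed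
  show "d \<in> (\<Union>b\<in>{b\<in>{1..length m}. sorted_wrt (<) (take b m)}.
     (\<lambda>d. replicate b (Suc j) @ d) ` ascending_below (Suc j) k (drop b m))"
  proof (rule UN_I)
    show "d \<in> (\<lambda>d. replicate b (Suc j) @ d) ` ascending_below (Suc j) k (drop b m)"
      by (rule image_eqI[where f = "\<lambda>d. replicate b (Suc j) @ d", OF d_eq e])
  qed (use b bm sorted_take in simp)
next
  fix d assume "d \<in> (\<Union>b\<in>{b\<in>{1..length m}. sorted_wrt (<) (take b m)}.
     (\<lambda>d. replicate b (Suc j) @ d) ` ascending_below (Suc j) k (drop b m))"
  then obtain b e where b: "1 \<le> b" "b \<le> length m" "sorted_wrt (<) (take b m)"
    and e: "e \<in> ascending_below (Suc j) k (drop b m)" and d: "d = replicate b (Suc j) @ e" by auto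
  have "zip d m = zip (replicate b (Suc j)) (take b m) @ zip e (drop b m)"
    by (simp add: d zip_append1)
  moreover have "sorted_wrt (<) (zip (replicate b (Suc j)) (take b m))"
    using b by (auto simp: sorted_wrt_iff_nth_less)
  moreover have "x < y" if "x \<in> set (zip (replicate b (Suc j)) (take b m))" "y \<in> set (zip e (drop b m))" for x y
  proof -
    have "fst x \<in> set (replicate b (Suc j))" "fst y \<in> set e"
      using that set_zip_leftD[of "fst x" "snd x" "replicate b (Suc j)" "take b m"]
        set_zip_leftD[of "fst y" "snd y" e "drop b m"] unfolding prod.collapse by blast+
    then have "fst x = Suc j" "Suc j < fst y"
      using e by (simp_all add: ascending_below_def)
    then show ?thesis by (simp add: less_prod_def')
  qed
  ultimately have "sorted_wrt (<) (zip d m)"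
    using e by (simp add: ascending_below_def sorted_wrt_append)
  moreover have "set d = insert (Suc j) {Suc j<..Suc j + k}" "length d = length m"
    using b e by (simp_all add: d ascending_below_def)
  moreover have "insert (Suc j) {Suc j<..Suc j + k} = {j<..j + Suc k}" by auto
  ultimately show "d \<in> ascending_below j (Suc k) m"
    by (simp add: ascending_below_def)
qed

text \<open>The union is disjoint because \<open>b\<close> is recovered as the number of occurrences
  of \<open>Suc j\<close>.\<close>

lemma card_ascending_below_Suc:
  "card (ascending_below j (Suc k) m) = (\<Sum>b\<in>{b\<in>{1..length m}. sorted_wrt (<) (take b m)}.
     card (ascending_below (Suc j) k (drop b m)))"
proof -
  have count: "count_list (replicate b (Suc j) @ e) (Suc j) = b"
    if "e \<in> ascending_below (Suc j) k m'" for b e m'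
  proof -
    have "count_list e (Suc j) = 0"
      using that by (intro count_notin) (simp add: ascending_below_def)
    moreover have "count_list (replicate b (Suc j)) (Suc j) = b" by (induction b) auto
    ultimately show ?thesis by simp
  qed
  show ?thesis unfolding ascending_below_Suc
  proof (subst card_UN_disjoint)
    show "\<forall>b\<in>{b \<in> {1..length m}. sorted_wrt (<) (take b m)}.
       \<forall>c\<in>{b \<in> {1..length m}. sorted_wrt (<) (take b m)}. b \<noteq> c \<longrightarrow>
        (\<lambda>d. replicate b (Suc j) @ d) ` ascending_below (Suc j) k (drop b m)
        \<inter> (\<lambda>d. replicate c (Suc j) @ d) ` ascending_below (Suc j) k (drop c m) = {}"
    proof (intro ballI impI, rule ccontr)
      fix b c assume "b \<noteq> c" and "(\<lambda>d. replicate b (Suc j) @ d) ` ascending_below (Suc j) k (drop b m)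
        \<inter> (\<lambda>d. replicate c (Suc j) @ d) ` ascending_below (Suc j) k (drop c m) \<noteq> {}"
      then obtain d e where "d \<in> ascending_below (Suc j) k (drop b m)"
        "e \<in> ascending_below (Suc j) k (drop c m)"
        "replicate b (Suc j) @ d = replicate c (Suc j) @ e" by blast
      then show False using count \<open>b \<noteq> c\<close> by metis
    qed
  qed (simp_all add: card_image inj_on_def)
qed

text \<open>A power of the series without its constant term counts the cuts of \<open>m\<close> into
  \<open>k\<close> nonempty strictly increasing factors. The offset \<open>j\<close> is arbitrary
  because each step of the induction raises it.\<close>

lemma nc_power_ascending_series:
  assumes "set m \<subseteq> {1..M}"
  shows "nc_power (nc_minus (ascending_series M) nc_one) k m
    = (of_nat (card (ascending_below j k m)) :: 'k::field_char_0)"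
  using assms
proof (induction k arbitrary: j m)
  case 0
  have "ascending_below j 0 m = (if m = [] then {[]} else {})"
    by (auto simp: ascending_below_def)
  then show ?case by (simp add: nc_one_def)
next
  case (Suc k)
  let ?f = "nc_minus (ascending_series M) nc_one :: 'k nc_series"
  have f: "?f (take b m) = (if 1 \<le> b \<and> sorted_wrt (<) (take b m) then 1 else 0)" if "b \<le> length m" for b
    using that Suc.prems set_take_subset[of b m]
    by (auto simp: nc_minus_def nc_one_def ascending_series_def Suc_le_eq)
  have "nc_power ?f (Suc k) m = (\<Sum>b\<le>length m. ?f (take b m) * nc_power ?f k (drop b m))"
    by (simp add: nc_mult_def)
  also have "\<dots> = (\<Sum>b\<le>length m. if 1 \<le> b \<and> sorted_wrt (<) (take b m)
      then of_nat (card (ascending_below (Suc j) k (drop b m))) else 0)"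
  proof (intro sum.cong refl)
    fix b assume "b \<in> {..length m}"
    moreover have "set (drop b m) \<subseteq> {1..M}"
      using Suc.prems set_drop_subset[of b m] by blast
    ultimately show "?f (take b m) * nc_power ?f k (drop b m) = (if 1 \<le> b \<and> sorted_wrt (<) (take b m)
        then of_nat (card (ascending_below (Suc j) k (drop b m))) else 0)"
      by (simp add: f Suc.IH[of "drop b m" "Suc j"])
  qed
  also have "\<dots> = of_nat (card (ascending_below j (Suc k) m))"
    by (simp add: card_ascending_below_Suc flip: sum.inter_filter) (intro sum.cong; auto)
  finally show ?case .
qed

text \<open>Grouping by \<open>k = max_letter d\<close> turns the sum into the coefficient of
  \<open>m\<close> in the power \<open>t\<close> of
  \<open>(1 + a\<^sub>1)\<cdots>(1 + a\<^sub>M)\<close>.\<close>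

lemma sum_t_choose_eq_powers:
  assumes "set m \<subseteq> {1..M}"
  shows "(\<Sum>d | d \<in> packed_words (length m) \<and> sorted_wrt (<) (zip d m). t_choose (max_letter d))
    = (\<Sum>k\<le>length m. smult (nc_power (nc_minus (ascending_series M) nc_one) k m)
        (t_choose k :: 'k::field_char_0 poly))" (is "sum _ ?P = _")
proof -
  have "max_letter d \<le> length m" if "d \<in> ?P" for d
    using that card_length[of d] packed_iff[of d] by (auto simp: packed_words_def)
  then have "(\<Sum>d\<in>?P. t_choose (max_letter d) :: 'k poly)
      = (\<Sum>k\<le>length m. \<Sum>d\<in>{d\<in>?P. max_letter d = k}. t_choose (max_letter d))"
    by (intro sum.group[symmetric]) auto
  also have "\<dots> = (\<Sum>k\<le>length m. \<Sum>d\<in>ascending_below 0 k m. t_choose k)"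
  proof (intro sum.cong refl)
    fix k
    have "packed d \<and> max_letter d = k \<longleftrightarrow> set d = {0<..0 + k}" for d
      using packed_iff[of d] max_letter_eq[of d k] atLeastSucAtMost_greaterThanAtMost[of 0 k]
      by auto
    then show "{d \<in> ?P. max_letter d = k} = ascending_below 0 k m"
      unfolding ascending_below_def packed_words_def by blast
  next
    fix k d assume "d \<in> ascending_below 0 k m"
    then have "max_letter d = k"
      using max_letter_eq[of d k] atLeastSucAtMost_greaterThanAtMost[of 0 k]
      by (simp add: ascending_below_def)
    then show "t_choose (max_letter d) = (t_choose k :: 'k poly)" by simp
  qed
  finally show ?thesis
    by (simp add: nc_power_ascending_series[OF assms, of _ 0] of_nat_poly)
qed

section \<open>Coordinates on the basis \<open>N\<^sub>u\<close>\<close>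

lemma length_packed_words: "u \<in> packed_words n \<Longrightarrow> length u = n"
  by (simp add: packed_words_def)

lemma lookup_scale: "Poly_Mapping.lookup (scale c f) w = c * Poly_Mapping.lookup f w"
  by (simp add: scale_def Poly_Mapping.map.rep_eq when_def)

lemma lookup_extend_scalars: "Poly_Mapping.lookup (extend_scalars f) w = [:Poly_Mapping.lookup f w:]"
  by (simp add: extend_scalars_def Poly_Mapping.map.rep_eq when_def)

lemma lookup_sigma_t:
  "Poly_Mapping.lookup (sigma_t n) u = (if u \<in> packed_words n then t_choose (max_letter u) else 0)"
proof -
  have "Poly_Mapping.lookup (sigma_t n) u
      = (\<Sum>w\<in>packed_words n. if w = u then t_choose (max_letter w) else 0)"
    unfolding sigma_t_def lookup_sum
    by (intro sum.cong) (auto simp: lookup_scale basis_N_def lookup_single when_def)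
  then show ?thesis by simp
qed

lemma lookup_E:
  "Poly_Mapping.lookup (E n k) u = (if u \<in> packed_words n then coeff (t_choose (max_letter u)) k else 0)"
  by (simp add: E_def Poly_Mapping.map.rep_eq lookup_sigma_t when_def)

text \<open>Ranges larger than the supports are allowed, so that sums can run over all packed words
  of one length.\<close>

lemma lookup_internal_product:
  assumes "finite A" "finite B" "Poly_Mapping.keys f \<subseteq> A" "Poly_Mapping.keys g \<subseteq> B"
    and "\<And>u v. u \<in> A \<Longrightarrow> v \<in> B \<Longrightarrow> length u = length v"
  shows "Poly_Mapping.lookup (f \<star> g) y = (\<Sum>u\<in>A. \<Sum>v\<in>B.
    if pack (zip u v) = y then Poly_Mapping.lookup f u * Poly_Mapping.lookup g v else 0)"
proof -
  let ?h = "\<lambda>u v. if pack (zip u v) = y then Poly_Mapping.lookup f u * Poly_Mapping.lookup g v else 0"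
  have "Poly_Mapping.lookup (f \<star> g) y
      = (\<Sum>u\<in>Poly_Mapping.keys f. \<Sum>v\<in>Poly_Mapping.keys g. ?h u v)"
    unfolding internal_product_def lookup_sum
    using assms(3-5) by (intro sum.cong refl) (auto simp: lookup_single when_def subset_iff)
  also have "\<dots> = (\<Sum>u\<in>A. \<Sum>v\<in>Poly_Mapping.keys g. ?h u v)"
    using assms by (intro sum.mono_neutral_left) (auto simp: in_keys_iff intro!: sum.neutral)
  also have "\<dots> = (\<Sum>u\<in>A. \<Sum>v\<in>B. ?h u v)"
    using assms by (intro sum.cong refl sum.mono_neutral_left) (auto simp: in_keys_iff)
  finally show ?thesis .
qed

lemma lookup_sigma_t_product:
  assumes "length v = n"
  shows "Poly_Mapping.lookup (sigma_t n \<star> basis_N v) y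
    = (\<Sum>u | u \<in> packed_words n \<and> pack (zip u v) = y. t_choose (max_letter u))"
proof -
  have "Poly_Mapping.lookup (sigma_t n \<star> basis_N v) y
      = (\<Sum>u\<in>packed_words n. \<Sum>w\<in>{v}. if pack (zip u w) = y
          then Poly_Mapping.lookup (sigma_t n) u * Poly_Mapping.lookup (basis_N v) w else 0)"
    using assms
    by (intro lookup_internal_product)
      (auto simp: in_keys_iff lookup_sigma_t basis_N_def lookup_single when_def length_packed_words split: if_splits)
  also have "\<dots> = (\<Sum>u\<in>packed_words n. if pack (zip u v) = y then t_choose (max_letter u) else 0)"
    by (intro sum.cong refl) (simp add: lookup_sigma_t basis_N_def)
  finally show ?thesis by (simp add: sum.inter_filter)
qed

text \<open>As \<open>E n k\<close> collects the coefficients of \<open>t ^ k\<close> in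
  \<open>sigma_t n\<close>, linearity makes \<open>K\<^sub>x\<close> the coefficient of
  \<open>t ^ max_letter x\<close> in the product of \<open>N\<^sub>x\<close> with
  \<open>sigma_t n\<close>.\<close>

lemma lookup_basis_K:
  "Poly_Mapping.lookup (basis_K x) y
    = coeff (\<Sum>u | u \<in> packed_words (length x) \<and> pack (zip x u) = y. t_choose (max_letter u)) (max_letter x)"
proof -
  let ?n = "length x"
  have "Poly_Mapping.lookup (basis_K x) y
      = (\<Sum>w\<in>{x}. \<Sum>u\<in>packed_words ?n. if pack (zip w u) = y
          then Poly_Mapping.lookup (basis_N x) w * Poly_Mapping.lookup (E ?n (max_letter x)) u else 0)"
    unfolding basis_K_def
    by (intro lookup_internal_product)
      (auto simp: in_keys_iff lookup_E basis_N_def lookup_single when_def length_packed_words split: if_splits)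
  also have "\<dots> = (\<Sum>u\<in>packed_words ?n.
      if pack (zip x u) = y then coeff (t_choose (max_letter u)) (max_letter x) else 0)"
    by (simp add: lookup_E basis_N_def cong: if_cong sum.cong)
  finally show ?thesis unfolding coeff_sum by (simp only: sum.inter_filter finite_packed_words)
qed

section \<open>Reduction to words of length \<open>max y\<close>\<close>

lemma inj_on_relabel: "packed y \<Longrightarrow> inj_on (relabel y) {s. length s = max_letter y}"
  by (simp add: inj_on_def relabel_inject)

lemma relabel_in_packed_words_iff:
  assumes "packed y" "length d = max_letter y"
  shows "relabel y d \<in> packed_words (length y) \<longleftrightarrow> d \<in> packed_words (max_letter y)"
  using assms by (simp add: packed_words_def packed_def set_relabel)

lemma max_letter_relabel:
  assumes "packed y" "length d = max_letter y"
  shows "max_letter (relabel y d) = max_letter d"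
  using assms by (simp add: max_letter_def set_relabel)

text \<open>Relabelling along \<open>y\<close> is injective and preserves the set of letters, hence
  both packedness and the maximum.\<close>

lemma sum_packed_words_relabel:
  assumes "packed y"
    and "\<And>u. u \<in> packed_words (length y) \<Longrightarrow>
      Q u \<longleftrightarrow> (\<exists>d. length d = max_letter y \<and> R d \<and> u = relabel y d)"
  shows "(\<Sum>u | u \<in> packed_words (length y) \<and> Q u. t_choose (max_letter u))
    = (\<Sum>d | d \<in> packed_words (max_letter y) \<and> R d. t_choose (max_letter d) :: 'k::field_char_0 poly)"
    (is "sum _ ?U = sum _ ?D")
proof -
  have length_D: "length d = max_letter y" if "d \<in> ?D" for d
    using that by (auto simp: packed_words_def)
  have "?U = relabel y ` ?D"
  proof (intro equalityI subsetI)
    fix u assume u: "u \<in> ?U"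
    then obtain d where d: "length d = max_letter y" "R d" "u = relabel y d"
      using assms(2) by blast
    then have "d \<in> ?D"
      using u relabel_in_packed_words_iff[OF assms(1) d(1)] by blast
    then show "u \<in> relabel y ` ?D" unfolding d(3) by (rule imageI)
  next
    fix u assume "u \<in> relabel y ` ?D"
    then obtain d where d: "u = relabel y d" "d \<in> ?D" by blast
    then have "u \<in> packed_words (length y)"
      using relabel_in_packed_words_iff[OF assms(1) length_D[OF d(2)]] by blast
    then show "u \<in> ?U" using assms(2)[of u] d length_D[OF d(2)] by blast
  qed
  moreover have "inj_on (relabel y) ?D"
    using length_D by (intro inj_on_subset[OF inj_on_relabel[OF assms(1)]]) blast
  ultimately have "(\<Sum>u\<in>?U. t_choose (max_letter u) :: 'k poly)
      = (\<Sum>d\<in>?D. t_choose (max_letter (relabel y d)))"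
    by (simp only: sum.reindex comp_def)
  also have "\<dots> = (\<Sum>d\<in>?D. t_choose (max_letter d))"
    using length_D by (intro sum.cong refl) (simp only: max_letter_relabel[OF assms(1)])
  finally show ?thesis .
qed

text \<open>For \<open>v = relabel y m\<close> this is the coefficient of \<open>N\<^sub>y\<close>
  in \<open>U\<^sub>v(t)\<close>; injectivity of relabelling forces the bottom row to be
  \<open>m\<close>.\<close>

lemma sum_pack_zip_left:
  assumes "packed y" "length m = max_letter y"
  shows "(\<Sum>u | u \<in> packed_words (length y) \<and> pack (zip u (relabel y m)) = y. t_choose (max_letter u))
    = (\<Sum>d | d \<in> packed_words (length m) \<and> sorted_wrt (<) (zip d m).
        t_choose (max_letter d) :: 'k::field_char_0 poly)"
  unfolding assms(2)
proof (rule sum_packed_words_relabel[OF assms(1)])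
  fix u assume "u \<in> packed_words (length y)"
  then have "length u = length (relabel y m)" by (simp add: packed_words_def)
  then show "pack (zip u (relabel y m)) = y \<longleftrightarrow>
      (\<exists>d. length d = max_letter y \<and> sorted_wrt (<) (zip d m) \<and> u = relabel y d)"
    using relabel_inject[OF assms(1) _ assms(2)] assms(2)
    by (subst pack_zip_eq_iff[OF assms(1)]) metis+
qed

text \<open>The same reduction with the fixed word on top, as needed for \<open>K\<^sub>x\<close>
  with \<open>x = relabel y c\<close>.\<close>

lemma sum_pack_zip_right:
  assumes "packed y" "length c = max_letter y"
  shows "(\<Sum>u | u \<in> packed_words (length y) \<and> pack (zip (relabel y c) u) = y. t_choose (max_letter u))
    = (\<Sum>d | d \<in> packed_words (length c) \<and> sorted_wrt (<) (zip c d).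
        t_choose (max_letter d) :: 'k::field_char_0 poly)"
  unfolding assms(2)
proof (rule sum_packed_words_relabel[OF assms(1)])
  fix u assume "u \<in> packed_words (length y)"
  then have "length (relabel y c) = length u" by (simp add: packed_words_def)
  then show "pack (zip (relabel y c) u) = y \<longleftrightarrow>
      (\<exists>d. length d = max_letter y \<and> sorted_wrt (<) (zip c d) \<and> u = relabel y d)"
    using relabel_inject[OF assms(1) _ assms(2)] assms(2)
    by (subst pack_zip_eq_iff[OF assms(1)]) metis+
qed

section \<open>Weakly increasing packed words, encoded by the multiplicities of their
  letters\<close>

definition block_word :: "nat list \<Rightarrow> nat list" where
  "block_word bs = expand (zip bs [1..<Suc (length bs)])"

lemma set_block_word:
  assumes "\<forall>b\<in>set bs. 0 < b"
  shows "set (block_word bs) = {1..length bs}"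
proof -
  have "\<forall>(b, a)\<in>set (zip bs [1..<Suc (length bs)]). 0 < b"
    using assms by (auto dest: set_zip_leftD simp del: upt_Suc)
  then have "set (block_word bs) = snd ` set (zip bs [1..<Suc (length bs)])"
    unfolding block_word_def by (rule set_expand_pos)
  also have "\<dots> = set (map snd (zip bs [1..<Suc (length bs)]))" by simp
  also have "map snd (zip bs [1..<Suc (length bs)]) = [1..<Suc (length bs)]"
    by (intro map_snd_zip) (simp del: upt_Suc)
  finally show ?thesis by (simp add: atLeastLessThanSuc_atLeastAtMost del: upt_Suc)
qed

lemma packed_block_word: "\<forall>b\<in>set bs. 0 < b \<Longrightarrow> packed (block_word bs)"
  unfolding packed_def by (rule exI, rule set_block_word)

lemma max_letter_block_word: "\<forall>b\<in>set bs. 0 < b \<Longrightarrow> max_letter (block_word bs) = length bs"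
  by (rule max_letter_eq, rule set_block_word)

lemma block_word_inject:
  assumes "block_word bs = block_word bs'" "\<forall>b\<in>set bs. 0 < b" "\<forall>b\<in>set bs'. 0 < b"
  shows "bs = bs'"
proof -
  have "length bs = length bs'"
    using max_letter_block_word[OF assms(2)] max_letter_block_word[OF assms(3)] assms(1) by simp
  moreover have "map (count_list (block_word as)) [1..<Suc (length as)] = as" for as
    unfolding block_word_def by (intro count_list_expand_zip) (simp_all del: upt_Suc)
  ultimately show ?thesis using assms(1) by metis
qed

lemma sorted_packed_is_block_word:
  assumes "sorted c" "packed c"
  shows "\<exists>bs. (\<forall>b\<in>set bs. 0 < b) \<and> length bs = max_letter c \<and> c = block_word bs"
proof -
  let ?as = "[1..<Suc (max_letter c)]"
  have set_c: "set c = {1..max_letter c}" using assms(2) by (simp only: packed_iff)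
  then have "expand (zip (map (count_list c) ?as) ?as) = c"
    using assms(1) by (intro expand_count_list sorted_wrt_upt) (auto simp del: upt_Suc)
  moreover have "0 < count_list c a" if "a \<in> set c" for a
    using that count_list_0_iff[of c a] by (cases "count_list c a") auto
  ultimately show ?thesis
    using set_c by (intro exI[of _ "map (count_list c) ?as"])
      (auto simp: block_word_def atLeastLessThanSuc_atLeastAtMost simp del: upt_Suc)
qed

lemma relabel_block_word:
  assumes "length z = length bs"
  shows "relabel (block_word bs) z = expand (zip bs z)"
proof -
  have "relabel (block_word bs) z = expand (map (apsnd (\<lambda>j. z ! (j - 1))) (zip bs [1..<Suc (length bs)]))"
    by (simp add: relabel_def block_word_def map_expand del: upt_Suc)
  also have "map (apsnd (\<lambda>j. z ! (j - 1))) (zip bs [1..<Suc (length bs)]) = zip bs z"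
    using assms by (intro nth_equalityI) (simp_all del: upt_Suc)
  finally show ?thesis .
qed

text \<open>The sum is the product of the \<open>t_choose b\<close>, whose coefficient in degree
  \<open>length bs\<close> is a product of logarithm coefficients. The letters in \<open>z\<close>
  are arbitrary because the weight depends on the block sizes alone.\<close>

lemma sum_t_choose_block_word:
  fixes bs z :: "nat list"
  assumes "\<forall>b\<in>set bs. 0 < b" "length z = length bs"
  shows "coeff (\<Sum>d | d \<in> packed_words (length (block_word bs)) \<and> sorted_wrt (<) (zip (block_word bs) d).
      t_choose (max_letter d)) (length bs) = (log_weight (zip bs z) :: 'k::field_char_0)"
proof -
  let ?p = "zip bs [1..<Suc (length bs)]"
  have snd_p: "map snd ?p = [1..<Suc (length bs)]" by (intro map_snd_zip) (simp del: upt_Suc)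
  have "(\<Sum>d | d \<in> packed_words (length (block_word bs)) \<and> sorted_wrt (<) (zip (block_word bs) d).
      t_choose (max_letter d)) = (prod_list (map (\<lambda>(b, _). t_choose b) ?p) :: 'k poly)"
    unfolding block_word_def by (intro sum_t_choose_expand) (simp only: snd_p sorted_wrt_upt)
  moreover have "coeff (prod_list (map (\<lambda>(b, _). t_choose b) ?p)) (length ?p)
      = (prod_list (map (\<lambda>(b, _). log_coeff b) ?p) :: 'k)"
    using assms(1) by (intro coeff_prod_t_choose) (auto dest: set_zip_leftD)
  moreover have "map (\<lambda>(b, _). log_coeff b) (zip bs w) = (map log_coeff bs :: 'k list)"
    if "length w = length bs" for w :: "nat list"
    using that by (intro nth_equalityI) simp_all
  ultimately show ?thesis using assms(2) by (simp add: log_weight_def del: upt_Suc)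
qed

section \<open>Comparison of the coefficients of \<open>N\<^sub>y\<close>\<close>

theorem mainTheorem6:
  fixes v :: "nat list" and n :: nat
  assumes "packed v" and "length v = n"
  shows "(sigma_t n \<star> basis_N v :: 'k::field_char_0 poly wqsym) =
    (\<Sum>x\<in>WRef v. scale (goldberg (refinement_word v x)) (extend_scalars (basis_K x)))"
proof (rule poly_mapping_eqI)
  fix y
  define F where "F x = goldberg (refinement_word v x) * [:Poly_Mapping.lookup (basis_K x) y :: 'k:]" for x
  have rhs: "Poly_Mapping.lookup (\<Sum>x\<in>WRef v. scale (goldberg (refinement_word v x))
      (extend_scalars (basis_K x :: 'k wqsym))) y = (\<Sum>x\<in>WRef v. F x)"
    by (simp add: lookup_sum lookup_scale lookup_extend_scalars F_def)
  have finite_WRef: "finite (WRef v)"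
    by (rule finite_subset[OF _ finite_packed_words[of "length v"]]) (auto simp: WRef_def)
  have F_nonzero: "\<exists>bs z. (\<forall>b\<in>set bs. 0 < b) \<and> length z = length bs \<and> packed y \<and> length y = n
      \<and> length (block_word bs) = max_letter y \<and> x = relabel y (block_word bs)
      \<and> v = relabel y (expand (zip bs z))" if x: "x \<in> WRef v" "F x \<noteq> 0" for x
  proof -
    have "Poly_Mapping.lookup (basis_K x :: 'k wqsym) y \<noteq> 0"
      using x(2) by (auto simp: F_def)
    \<comment> \<open>A nonzero coefficient requires a nonempty range of summation in
      \<open>lookup_basis_K\<close>.\<close>
    then obtain u where u: "u \<in> packed_words (length x)" "pack (zip x u) = y"
      unfolding lookup_basis_K by (metis (mono_tags, lifting) coeff_0 mem_Collect_eq sum.neutral)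
    obtain z where z: "packed x" "length x = n" "length z = max_letter x" "v = relabel x z"
      using x(1) assms(2) unfolding WRef_iff by blast
    have y: "packed y" "length y = n"
      using u z packed_pack[of "zip x u"] length_pack[of "zip x u"] by (auto simp: packed_words_def)
    have len: "length x = length u" using u by (simp add: packed_words_def)
    then obtain c and d :: "nat list" where c: "length c = max_letter y" "length d = max_letter y"
      "sorted_wrt (<) (zip c d)" "x = relabel y c"
      using pack_zip_eq_iff[OF y(1) len] u(2) by blast
    \<comment> \<open>The top row of a strictly increasing biword increases weakly. Being packed as
      well, \<open>c\<close> is a block word, so \<open>x\<close> merges consecutive letters of
      \<open>y\<close>.\<close>
    have "sorted c" using sorted_wrt_zip_fst[OF c(3)] c by simp
    moreover have "packed c"
      using z(1) c y(1) by (simp add: packed_def set_relabel)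
    ultimately obtain bs where bs: "\<forall>b\<in>set bs. 0 < b" "length bs = max_letter c" "c = block_word bs"
      using sorted_packed_is_block_word by blast
    have "length z = length bs"
      using z(3) c bs max_letter_relabel[OF y(1) c(1)] by simp
    moreover have "v = relabel y (expand (zip bs z))"
      using z(4) c relabel_relabel[OF y(1) c(1), of z] bs(3) relabel_block_word[OF \<open>length z = length bs\<close>]
      by simp
    ultimately show ?thesis using bs c y by blast
  qed
  have "(\<Sum>u | u \<in> packed_words n \<and> pack (zip u v) = y. t_choose (max_letter u)) = (\<Sum>x\<in>WRef v. F x)"
  \<comment> \<open>By \<open>WRef_iff\<close> the condition says that \<open>y\<close> is a weak
    refinement of \<open>v\<close>.\<close>
  proof (cases "packed y \<and> length y = n \<and> (\<exists>m. length m = max_letter y \<and> v = relabel y m)")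
    case False
    have none: "{u. u \<in> packed_words n \<and> pack (zip u v) = y} = {}"
    proof (rule equals0I)
      fix u assume u: "u \<in> {u. u \<in> packed_words n \<and> pack (zip u v) = y}"
      then have len: "length u = length v" and "packed y"
        using assms(2) packed_pack[of "zip u v"] by (auto simp: packed_words_def)
      moreover have "length y = n"
        using u len assms(2) length_pack[of "zip u v"] by auto
      ultimately show False
        using u False pack_zip_eq_iff[OF \<open>packed y\<close> len] by blast
    qed
    have "F x = 0" if x: "x \<in> WRef v" for x
    proof (rule ccontr)
      assume "F x \<noteq> 0"
      then obtain bs z where bs: "length z = length bs" "packed y" "length y = n"
        "length (block_word bs) = max_letter y" "v = relabel y (expand (zip bs z))"
        using F_nonzero[OF x] by blast
      then have "length (expand (zip bs z)) = max_letter y"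
        using relabel_block_word[OF bs(1)] length_relabel[of "block_word bs" z] by simp
      then show False using bs False by blast
    qed
    then have "(\<Sum>x\<in>WRef v. F x) = 0" by (intro sum.neutral) blast
    then show ?thesis by (simp only: none sum.empty)
  next
    case True
    then obtain m where y: "packed y" "length y = n" and m: "length m = max_letter y" "v = relabel y m"
      by blast
    \<comment> \<open>Merge the letters of \<open>y\<close> along the blocks of \<open>p\<close>:
      those in the \<open>i\<close>-th block all become \<open>i\<close>.\<close>
    define X where "X p = relabel y (block_word (map fst p))" for p :: "(nat \<times> nat) list"
    have pos: "\<forall>b\<in>set (map fst p). 0 < b" if "p \<in> block_decomps m" for p
      using that by (auto simp: block_decomps_def)
    have relabel_p: "relabel (block_word (map fst p)) (map snd p) = m" if "p \<in> block_decomps m" for p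
      using that relabel_block_word[of "map snd p" "map fst p"]
      by (simp add: zip_map_fst_snd block_decomps_def)
    have len_p: "length (block_word (map fst p)) = max_letter y" if "p \<in> block_decomps m" for p
      using relabel_p[OF that] m(1) by (metis length_relabel)
    have X: "packed (X p)" "length (X p) = n" "max_letter (X p) = length p" "v = relabel (X p) (map snd p)"
      if "p \<in> block_decomps m" for p
    proof -
      show "packed (X p)"
        using packed_block_word[OF pos[OF that]] set_relabel[OF y(1) len_p[OF that]]
        by (simp add: X_def packed_def)
      show "length (X p) = n" using y by (simp add: X_def)
      show "max_letter (X p) = length p"
        using max_letter_block_word[OF pos[OF that]] max_letter_relabel[OF y(1) len_p[OF that]]
        by (simp add: X_def)
      show "v = relabel (X p) (map snd p)"
        using relabel_relabel[OF y(1) len_p[OF that], of "map snd p"] relabel_p[OF that] m(2)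
        by (simp add: X_def)
    qed
    have ref: "refinement_word v (X p) = map snd p" if "p \<in> block_decomps m" for p
      using refinement_word_relabel[OF X(1)[OF that], of "map snd p"] X(3,4)[OF that] by simp
    have F_X: "F (X p) = goldberg (map snd p) * [:log_weight p:]" if "p \<in> block_decomps m" for p
    proof -
      have "Poly_Mapping.lookup (basis_K (X p)) y = (log_weight (zip (map fst p) (map snd p)) :: 'k)"
        unfolding lookup_basis_K X(3)[OF that]
        using sum_pack_zip_right[OF y(1) len_p[OF that], where 'k = 'k] y(2) X(2)[OF that]
          sum_t_choose_block_word[OF pos[OF that], of "map snd p", where 'k = 'k]
        by (simp add: X_def)
      then show ?thesis by (simp add: F_def ref[OF that] zip_map_fst_snd)
    qed
    have inj: "inj_on X (block_decomps m)"
    proof (rule inj_onI)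
      fix p q assume pq: "p \<in> block_decomps m" "q \<in> block_decomps m" "X p = X q"
      then have "map snd p = map snd q" using ref by metis
      moreover have "block_word (map fst p) = block_word (map fst q)"
        using pq relabel_inject[OF y(1) len_p[OF pq(1)] len_p[OF pq(2)]] by (simp add: X_def)
      then have "map fst p = map fst q"
        using block_word_inject pos pq by blast
      ultimately show "p = q" by (metis zip_map_fst_snd)
    qed
    \<comment> \<open>By \<open>F_nonzero\<close> any other \<open>x\<close> contributes 0: a
      contributing \<open>x\<close> comes from sizes \<open>bs\<close> and letters \<open>z\<close>,
      and since \<open>m\<close> is unique, \<open>zip bs z\<close> is a block decomposition of
      \<open>m\<close>.\<close>
    have "(\<Sum>x\<in>WRef v. F x) = (\<Sum>x\<in>X ` block_decomps m. F x)"
    proof (rule sum.mono_neutral_right[OF finite_WRef])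
      show "X ` block_decomps m \<subseteq> WRef v"
      proof
        fix x assume "x \<in> X ` block_decomps m"
        then obtain p where "p \<in> block_decomps m" "x = X p" by blast
        then show "x \<in> WRef v"
          unfolding WRef_iff using X[of p] assms(2) by (auto intro!: exI[of _ "map snd p"])
      qed
      show "\<forall>x\<in>WRef v - X ` block_decomps m. F x = 0"
      proof (intro ballI, rule ccontr)
        fix x assume x: "x \<in> WRef v - X ` block_decomps m" "F x \<noteq> 0"
        then obtain bs z where bs: "\<forall>b\<in>set bs. 0 < b" "length z = length bs"
          "length (block_word bs) = max_letter y" "x = relabel y (block_word bs)"
          "v = relabel y (expand (zip bs z))"
          using F_nonzero[of x] by blast
        have "length (expand (zip bs z)) = max_letter y"
          using bs(3) relabel_block_word[OF bs(2)] length_relabel[of "block_word bs" z] by simp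
        then have "expand (zip bs z) = m"
          using relabel_inject[OF y(1) _ m(1)] m(2) bs(5) by simp
        then have "zip bs z \<in> block_decomps m"
          using bs(1) by (auto simp: block_decomps_def dest: set_zip_leftD)
        moreover have "x = X (zip bs z)" using bs by (simp add: X_def)
        ultimately show False using x by blast
      qed
    qed
    also have "\<dots> = (\<Sum>p\<in>block_decomps m. goldberg (map snd p) * [:log_weight p:])"
      using F_X by (simp add: sum.reindex[OF inj])
    also have "\<dots> = (\<Sum>d | d \<in> packed_words (length m) \<and> sorted_wrt (<) (zip d m). t_choose (max_letter d))"
    proof -
      \<comment> \<open>The words \<open>m\<close> and \<open>v\<close> have the same set of
        letters, so the variables up to \<open>max_letter v\<close> suffice.\<close>
      have M: "set m \<subseteq> {1..max_letter v}"
        using set_relabel[OF y(1) m(1)] m(2) packed_iff[THEN iffD1, OF assms(1)] by simp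
      then have "set m \<subseteq> {..max_letter v}" by auto
      then show ?thesis
        by (simp only: sum_goldberg_block_decomps sum_t_choose_eq_powers[OF M])
    qed
    finally show ?thesis
      using sum_pack_zip_left[OF y(1) m(1), where 'k = 'k] y(2) m(2) by simp
  qed
  then show "Poly_Mapping.lookup (sigma_t n \<star> basis_N v) y
    = Poly_Mapping.lookup (\<Sum>x\<in>WRef v. scale (goldberg (refinement_word v x))
        (extend_scalars (basis_K x :: 'k wqsym))) y"
    unfolding rhs lookup_sigma_t_product[OF assms(2)] .
qed

end
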